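(* Let $v$ be any integer. For integers $n\geq1$ with $n+v\geq0$ define $\Psi_n(v)$ by \[ 1+\frac{1!}{n}+\frac{2!}{n^2}+\cdots+\frac{(n+v-1)!}{n^{n+v-1}}+\frac{(n+v)!}{n^{n+v}}\Psi_n(v)=ne^{-n}\,\mathrm{Ei}(n). \] Then for every integer $R\geq1$, as $n\to\infty$, \[ \Psi_n(v)=\psi_0(v)+\frac{\psi_1(v)}{n}+\cdots+\frac{\psi_{R-1}(v)}{n^{R-1}}+O\!\left(\frac1{n^R}\right), \] with an implied constant depending only on $R$ and $v$, where \[ \psi_r(v)=\sum_{m=0}^{r}\tau_{r-m}(v)\sum_{k=0}^{m}(-1)^k\mathcal{A}_{m,k}\big(\gamma_1(v),\gamma_2(v),\dots\big). \]
   Context: $\mathrm{Ei}(n)=\lim_{\varepsilon\to0^+}\left(\int_{-\infty}^{-\varepsilon}\frac{e^t}{t}dt+\int_{\varepsilon}^{n}\frac{e^t}{t}dt\right)$. De Moivre polynomial $\mathcal{A}_{n,k}(a_1,a_2,\dots)$: coefficient of $x^n$ in $(a_1x+a_2x^2+\cdots)^k$ (so $\mathcal{A}_{0,0}=1$, $\mathcal{A}_{n,k}=0$ for $n<k$). Double factorial usual with $0!!=(-1)!!=1$; $\binom{v}{j}=v(v-1)\cdots(v-j+1)/j!$. Here $\gamma_r(v)=\sum_{m=0}^{2r}(-1)^m\binom{v}{2r-m}\sum_{k=0}^{m}\frac{(2r+2k-1)!!}{(-1)^k k!}\mathcal{A}_{m,k}(\frac13,\frac14,\frac15,\dots)$ and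 $\tau_r(v)=\sum_{m=0}^{2r+1}(-1)^{m+1}\binom{v}{2r+1-m}\sum_{k=0}^{m}\frac{(2r+2k-1)!!}{(-1)^k k!}\mathcal{A}_{m,k}(\frac13,\frac14,\frac15,\dots)$. *)

theory Defs
  imports "HOL-Analysis.Analysis" "HOL-Computational_Algebra.Formal_Power_Series"
          "HOL-Library.Landau_Symbols"
begin

definition Ei :: "real \<Rightarrow> real" where
  "Ei x = Lim (at_right 0)
     (\<lambda>\<epsilon>. (LBINT t=-\<infinity>..ereal (-\<epsilon>). exp t / t) + (LBINT t=ereal \<epsilon>..ereal x. exp t / t))"

definition demoivre :: "(nat \<Rightarrow> real) \<Rightarrow> nat \<Rightarrow> nat \<Rightarrow> real" where
  "demoivre a n k = fps_nth ((Abs_fps (\<lambda>j. if j = 0 then 0 else a j)) ^ k) n"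

text \<open>Double factorial on nat; since 0 - 1 = 0 on nat, dfact (0 - 1) = 1 = (-1)!!.\<close>
fun dfact :: "nat \<Rightarrow> nat" where
  "dfact 0 = 1"
| "dfact (Suc 0) = 1"
| "dfact (Suc (Suc n)) = Suc (Suc n) * dfact n"

definition inner_sum :: "nat \<Rightarrow> nat \<Rightarrow> real" where
  "inner_sum r m = (\<Sum>k=0..m. real (dfact (2*r + 2*k - 1)) / ((-1)^k * fact k)
                      * demoivre (\<lambda>j. 1 / real (j + 2)) m k)"

definition gammaR :: "nat \<Rightarrow> int \<Rightarrow> real" where
  "gammaR r v = (\<Sum>m=0..2*r. (-1)^m * ((real_of_int v) gchoose (2*r - m)) * inner_sum r m)"

definition tauR :: "nat \<Rightarrow> int \<Rightarrow> real" where
  "tauR r v = (\<Sum>m=0..2*r+1. (-1)^(m+1) * ((real_of_int v) gchoose (2*r + 1 - m)) * inner_sum r m)"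

definition psiR :: "nat \<Rightarrow> int \<Rightarrow> real" where
  "psiR r v = (\<Sum>m=0..r. tauR (r - m) v *
      (\<Sum>k=0..m. (-1)^k * demoivre (\<lambda>j. gammaR j v) m k))"

text \<open>Psi_n(v), solved from its defining identity (meaningful when n \<ge> 1, n + v \<ge> 0).\<close>
definition PsiN :: "nat \<Rightarrow> int \<Rightarrow> real" where
  "PsiN n v = (real n * exp (- real n) * Ei (real n)
                 - (\<Sum>j<nat (int n + v). fact j / real n ^ j))
              * real n ^ nat (int n + v) / fact (nat (int n + v))"

end

theory Submission
  imports Defs "HOL-Probability.Sinc_Integral" "HOL-Real_Asymp.Real_Asymp"
begin

text \<open>
  Put \<open>N = n + v\<close> and \<open>f(x) = (1 + x)\<^sup>N e\<^bsup>-n x\<^esup>\<close>. Substituting \<open>t = -n x\<close> in \<open>Ei(n)\<close> and splitting off the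
  geometric sum \<open>((1 + x)\<^sup>N - 1) / x\<close>, whose terms integrate to factorials, shows that \<open>\<Psi>\<^sub>n(v)\<close> is
  minus the quotient of the principal value of \<open>\<integral> f(x) / x dx\<close> by \<open>\<integral> f(x) dx\<close>, both over \<open>x > -1\<close>.
  Both integrals have the Laplace form \<open>f(x) = e\<^bsup>-n x\<^sup>2/2\<^esup> e\<^bsup>n x\<^sup>2 w(x)\<^esup> (1 + x)\<^sup>v\<close> with
  \<open>w(x) = x/3 - x\<^sup>2/4 + \<dots>\<close>. Expanding the second exponential and the powers of \<open>w\<close>, with an error that is
  uniformly \<open>O(|x|\<^sup>K e\<^bsup>-n x\<^sup>2/12\<^esup>)\<close> for \<open>|x| \<le> 1/2\<close>, and integrating against Gaussian moments gives
  asymptotic series with coefficients \<open>\<gamma>\<^sub>r(v)\<close> and \<open>-\<tau>\<^sub>r(v)\<close>; the remaining range is exponentially small.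
  Finally \<open>\<psi>\<close> is the formal quotient \<open>\<tau> / \<gamma>\<close>.
\<close>

subsection \<open>Local approximation of the integrand\<close>

text \<open>The remainder is \<open>x ^ M\<close> times the shifted series, whose sum is continuous
  and hence bounded on the compact ball of radius \<open>\<rho>\<close>.\<close>

lemma fps_taylor_bound:
  fixes F :: "real fps"
  assumes "ereal \<rho> < fps_conv_radius F"
  obtains B where "B \<ge> 0"
    "\<And>x. \<bar>x\<bar> \<le> \<rho> \<Longrightarrow> \<bar>eval_fps F x - (\<Sum>m<M. fps_nth F m * x ^ m)\<bar> \<le> B * \<bar>x\<bar> ^ M"
proof -
  let ?S = "fps_shift M F"
  have sub: "cball (0::real) \<rho> \<subseteq> eball 0 (fps_conv_radius ?S)"
  proof
    fix x :: real assume "x \<in> cball 0 \<rho>"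
    then have "ereal (dist 0 x) \<le> ereal \<rho>" by simp
    from le_less_trans[OF this assms] show "x \<in> eball 0 (fps_conv_radius ?S)"
      by (simp del: dist_0_norm)
  qed
  have "continuous_on (cball 0 \<rho>) (eval_fps ?S)"
    by (rule continuous_on_subset[OF continuous_on_eval_fps sub])
  then have "bounded (eval_fps ?S ` cball 0 \<rho>)"
    by (intro compact_imp_bounded compact_continuous_image) auto
  then obtain B where B: "B > 0" "\<And>x. x \<in> cball 0 \<rho> \<Longrightarrow> \<bar>eval_fps ?S x\<bar> \<le> B"
    unfolding bounded_pos by auto
  have "\<bar>eval_fps F x - (\<Sum>m<M. fps_nth F m * x ^ m)\<bar> \<le> B * \<bar>x\<bar> ^ M" if "\<bar>x\<bar> \<le> \<rho>" for x
  proof -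
    have x: "ereal (norm x) < fps_conv_radius F"
      using that assms by (auto intro: le_less_trans[of _ "ereal \<rho>"])
    have "eval_fps F x = (\<Sum>m. fps_nth F (m + M) * x ^ (m + M)) + (\<Sum>m<M. fps_nth F m * x ^ m)"
      unfolding eval_fps_def by (rule suminf_split_initial_segment[OF summable_fps[OF x]])
    also have "(\<Sum>m. fps_nth F (m + M) * x ^ (m + M)) = (\<Sum>m. x ^ M * (fps_nth ?S m * x ^ m))"
      by (simp add: power_add mult_ac)
    also have "\<dots> = x ^ M * eval_fps ?S x"
      unfolding eval_fps_def by (rule suminf_mult[OF summable_fps]) (use x in simp)
    finally have "\<bar>eval_fps F x - (\<Sum>m<M. fps_nth F m * x ^ m)\<bar> = \<bar>x\<bar> ^ M * \<bar>eval_fps ?S x\<bar>"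
      by (simp add: abs_mult power_abs)
    also have "\<dots> \<le> \<bar>x\<bar> ^ M * B"
      by (intro mult_left_mono B) (use that in auto)
    finally show ?thesis by (simp add: mult.commute)
  qed
  then show ?thesis using B(1) by (intro that[of B]) auto
qed

text \<open>The series of \<open>(ln (1 + x) - x + x\<^sup>2 / 2) / x\<^sup>2\<close>, the
  \<open>w(x)\<close> of the overview. Its constant term vanishes, so its \<open>k\<close>-th power
  starts at order \<open>k\<close>.\<close>

definition phase_fps :: "real fps" where
  "phase_fps = Abs_fps (\<lambda>j. if j = 0 then 0 else (-1) ^ (j + 1) / real (j + 2))"

lemma fps_conv_radius_phase: "fps_conv_radius phase_fps \<ge> 1"
  unfolding fps_conv_radius_def
proof (rule conv_radius_geI_ex')
  fix r :: real assume r: "0 < r" "ereal r < 1"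
  show "summable (\<lambda>n. fps_nth phase_fps n * of_real r ^ n)"
  proof (rule summable_comparison_test')
    show "summable (\<lambda>n. r ^ n)" using r by (intro summable_geometric) auto
    show "norm (fps_nth phase_fps n * of_real r ^ n) \<le> r ^ n" for n
      using r by (auto simp: phase_fps_def abs_mult power_abs field_simps)
  qed
qed

lemma eval_phase_fps:
  assumes "\<bar>x\<bar> < 1"
  shows "x\<^sup>2 * eval_fps phase_fps x = ln (1 + x) - x + x\<^sup>2 / 2"
proof -
  define f where "f = (\<lambda>n. - ((-x) ^ n) / real n)"
  have "f sums ln (1 + x)" unfolding f_def using assms by (rule ln_series')
  \<comment> \<open>The two dropped terms are \<open>f 0 = 0\<close>, by division by zero, and
    \<open>f 1 = x\<close>.\<close>
  then have "(\<lambda>n. f (n + 2)) sums (ln (1 + x) - x)"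
    by (subst sums_iff_shift) (simp add: f_def numeral_2_eq_2)
  \<comment> \<open>This correction cancels \<open>f 2 = - (x\<^sup>2 / 2)\<close>, matching the
    zero constant term of \<open>phase_fps\<close>.\<close>
  moreover have "(\<lambda>n. if n = 0 then x\<^sup>2 / 2 else 0) sums (x\<^sup>2 / 2)"
    using sums_single[of 0 "\<lambda>_. x\<^sup>2 / 2"] by simp
  ultimately have "(\<lambda>n. f (n + 2) + (if n = 0 then x\<^sup>2 / 2 else 0)) sums (ln (1 + x) - x + x\<^sup>2 / 2)"
    by (rule sums_add)
  also have "(\<lambda>n. f (n + 2) + (if n = 0 then x\<^sup>2 / 2 else 0)) = (\<lambda>n. x\<^sup>2 * (fps_nth phase_fps n * x ^ n))"
    by (auto simp: fun_eq_iff f_def phase_fps_def power_minus[of x] power2_eq_square mult_ac)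
  finally have 1: "(\<lambda>n. x\<^sup>2 * (fps_nth phase_fps n * x ^ n)) sums (ln (1 + x) - x + x\<^sup>2 / 2)" .
  have "ereal (norm x) < fps_conv_radius phase_fps"
    using assms fps_conv_radius_phase by (auto intro: less_le_trans[of _ 1])
  then have "(\<lambda>n. x\<^sup>2 * (fps_nth phase_fps n * x ^ n)) sums (x\<^sup>2 * eval_fps phase_fps x)"
    unfolding eval_fps_def by (intro sums_mult summable_sums summable_fps)
  then show ?thesis using 1 by (rule sums_unique2)
qed

text \<open>The coefficients are at most \<open>1 / 3\<close> in absolute value and the constant one
  is zero, so a geometric series bounds the sum by
  \<open>\<bar>x\<bar> / (3 * (1 - \<bar>x\<bar>))\<close>. Since \<open>1 / 3 < 1 / 2\<close>, the
  Gaussian can later absorb the factor \<open>exp (n * x\<^sup>2 * w(x))\<close>.\<close>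

lemma eval_phase_fps_bound:
  assumes "\<bar>x\<bar> \<le> 1 / 2"
  shows "\<bar>eval_fps phase_fps x\<bar> \<le> 1 / 3"
proof -
  have x: "ereal (norm x) < fps_conv_radius phase_fps"
    using assms fps_conv_radius_phase by (auto intro: less_le_trans[of _ 1])
  have "(\<lambda>n. (1/3) * (\<bar>x\<bar> * \<bar>x\<bar> ^ n)) sums ((1/3) * (\<bar>x\<bar> * (1 / (1 - \<bar>x\<bar>))))"
    by (intro sums_mult geometric_sums) (use assms in auto)
  then have g: "(\<lambda>n. \<bar>x\<bar> ^ Suc n / 3) sums (\<bar>x\<bar> / (3 * (1 - \<bar>x\<bar>)))" by simp
  have s: "summable (\<lambda>n. fps_nth phase_fps n * x ^ n)" by (rule summable_fps[OF x])
  have "eval_fps phase_fps x = (\<Sum>n. fps_nth phase_fps (Suc n) * x ^ Suc n)"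
    unfolding eval_fps_def using suminf_split_head[OF s] by (simp add: phase_fps_def)
  also have "\<bar>\<dots>\<bar> \<le> (\<Sum>n. \<bar>x\<bar> ^ Suc n / 3)"
  proof -
    have "norm (\<Sum>n. fps_nth phase_fps (Suc n) * x ^ Suc n) \<le> (\<Sum>n. \<bar>x\<bar> ^ Suc n / 3)"
    proof (rule norm_suminf_le)
      show "norm (fps_nth phase_fps (Suc n) * x ^ Suc n) \<le> \<bar>x\<bar> ^ Suc n / 3" for n
      proof -
        have "norm (fps_nth phase_fps (Suc n) * x ^ Suc n) = \<bar>x\<bar> ^ Suc n * (1 / real (n + 3))"
          by (simp add: phase_fps_def abs_mult power_abs del: power_Suc)
        also have "\<dots> \<le> \<bar>x\<bar> ^ Suc n * (1 / 3)"
          by (intro mult_left_mono) (auto simp: field_simps)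
        finally show ?thesis by simp
      qed
      show "summable (\<lambda>n. \<bar>x\<bar> ^ Suc n / 3)" using g by (rule sums_summable)
    qed
    then show ?thesis by simp
  qed
  also have "\<dots> = \<bar>x\<bar> / (3 * (1 - \<bar>x\<bar>))" using g by (simp add: sums_iff)
  also have "\<dots> \<le> 1 / 3" using assms by (simp add: field_simps)
  finally show ?thesis .
qed

definition laplace_fun :: "int \<Rightarrow> nat \<Rightarrow> real \<Rightarrow> real" where
  "laplace_fun v n x = (1 + x) ^ nat (int n + v) * exp (- (real n * x))"

text \<open>Splitting the exponent \<open>n + v\<close> confines the dependence on \<open>n\<close>
  to exponentials in \<open>n * x\<^sup>2\<close> and leaves a fixed power of
  \<open>1 + x\<close>.\<close>

lemma laplace_eq_gaussian:
  assumes "\<bar>x\<bar> < 1" "int n + v \<ge> 0"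
  shows "laplace_fun v n x = exp (- (real n * x\<^sup>2 / 2)) * exp (real n * x\<^sup>2 * eval_fps phase_fps x)
           * (1 + x) powr real_of_int v"
proof -
  have "(1 + x) ^ nat (int n + v) = exp (real (nat (int n + v)) * ln (1 + x))"
    using assms(1) by (subst exp_of_nat_mult) (simp only: exp_ln)
  also have "real (nat (int n + v)) = real n + real_of_int v"
    using assms by simp
  also have "exp ((real n + real_of_int v) * ln (1 + x)) = exp (real n * ln (1 + x)) * (1 + x) powr real_of_int v"
    using assms by (simp add: powr_def exp_add[symmetric] algebra_simps)
  finally have "laplace_fun v n x = exp (real n * (ln (1 + x) - x)) * (1 + x) powr real_of_int v"
    by (simp add: laplace_fun_def exp_add[symmetric] exp_diff exp_minus field_simps)
  also have "ln (1 + x) - x = x\<^sup>2 * eval_fps phase_fps x - x\<^sup>2 / 2"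
    using eval_phase_fps[OF assms(1)] by simp
  finally show ?thesis by (simp add: exp_add[symmetric] algebra_simps)
qed

text \<open>The Taylor coefficients at 0 of \<open>w(x) ^ k * (1 + x) powr v\<close>.\<close>

definition laplace_coeff :: "int \<Rightarrow> nat \<Rightarrow> nat \<Rightarrow> real" where
  "laplace_coeff v k m = fps_nth (phase_fps ^ k * fps_binomial (real_of_int v)) m"

lemma laplace_coeff_taylor:
  obtains B where "B \<ge> 0"
    "\<And>x. \<bar>x\<bar> \<le> 1 / 2 \<Longrightarrow> \<bar>eval_fps phase_fps x ^ k * (1 + x) powr real_of_int v
        - (\<Sum>m<M. laplace_coeff v k m * x ^ m)\<bar> \<le> B * \<bar>x\<bar> ^ M"
proof -
  let ?b = "fps_binomial (real_of_int v)"
  let ?F = "phase_fps ^ k * ?b"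
  have rb: "fps_conv_radius ?b \<ge> 1" by (simp add: fps_conv_radius_binomial)
  have rp: "fps_conv_radius (phase_fps ^ k) \<ge> 1"
    using fps_conv_radius_phase fps_conv_radius_power order_trans by blast
  have "fps_conv_radius ?F \<ge> 1"
    by (rule order_trans[OF _ fps_conv_radius_mult]) (use rb rp in simp)
  then have "ereal (1/2) < fps_conv_radius ?F" by (rule less_le_trans[rotated]) simp
  then obtain B where B: "B \<ge> 0"
    "\<And>x. \<bar>x\<bar> \<le> 1/2 \<Longrightarrow> \<bar>eval_fps ?F x - (\<Sum>m<M. fps_nth ?F m * x ^ m)\<bar> \<le> B * \<bar>x\<bar> ^ M"
    by (rule fps_taylor_bound) blast
  have "eval_fps ?F x = eval_fps phase_fps x ^ k * (1 + x) powr real_of_int v" if "\<bar>x\<bar> \<le> 1 / 2" for x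
  proof -
    have x: "ereal (norm x) < 1" using that by simp
    have "eval_fps ?F x = eval_fps (phase_fps ^ k) x * eval_fps ?b x"
      by (intro eval_fps_mult less_le_trans[OF x] rb rp)
    also have "eval_fps (phase_fps ^ k) x = eval_fps phase_fps x ^ k"
      by (intro eval_fps_power less_le_trans[OF x] fps_conv_radius_phase)
    also have "eval_fps ?b x = (1 + x) powr real_of_int v"
      unfolding eval_fps_def using gen_binomial_real[of x "real_of_int v"] that
      by (simp add: sums_iff)
    finally show ?thesis .
  qed
  with B show ?thesis by (intro that[of B]) (auto simp: laplace_coeff_def)
qed

text \<open>A single term of the series of \<open>exp (t / 12)\<close> is at most the whole
  sum.\<close>

lemma power_times_exp_bound:
  fixes t :: real
  assumes "t \<ge> 0"
  shows "t ^ k * exp (- (t / 12)) \<le> 12 ^ k * fact k"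
proof -
  have s: "(\<lambda>n. (t / 12) ^ n /\<^sub>R fact n) sums exp (t / 12)"
    by (rule exp_converges)
  have "(\<Sum>n\<in>{k}. (t / 12) ^ n /\<^sub>R fact n) \<le> (\<Sum>n. (t / 12) ^ n /\<^sub>R fact n)"
    using sums_summable[OF s] by (rule sum_le_suminf) (simp_all add: assms)
  also have "\<dots> = exp (t / 12)" using sums_unique[OF s] by (rule sym)
  finally have "(t / 12) ^ k / fact k \<le> exp (t / 12)" by (simp add: field_simps)
  then show ?thesis by (simp add: exp_minus field_simps power_divide)
qed

text \<open>The exponential series in \<open>n * x\<^sup>2 * w(x)\<close> and the Taylor series of
  each \<open>w(x) ^ k * (1 + x) powr v\<close> are both cut at order \<open>K\<close>. What remains
  is a Gaussian times a polynomial.\<close>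

definition laplace_approx :: "int \<Rightarrow> nat \<Rightarrow> nat \<Rightarrow> real \<Rightarrow> real" where
  "laplace_approx v K n x = exp (- (real n * x\<^sup>2 / 2)) *
     (\<Sum>k<K. real n ^ k / fact k * x ^ (2 * k) * (\<Sum>m<K. laplace_coeff v k m * x ^ m))"

text \<open>Cutting the exponential series leaves a factor \<open>w(x) ^ K\<close>, cutting the
  Taylor series a factor \<open>x ^ K\<close>; both errors are of order
  \<open>\<bar>x\<bar> ^ K\<close> times powers of \<open>t = n * x\<^sup>2\<close>. Part of the
  Gaussian decay absorbs these powers, which makes \<open>B\<close> independent of
  \<open>n\<close>.\<close>

lemma laplace_local_bound:
  obtains B where "B \<ge> 0"
    "\<And>n x. int n + v \<ge> 0 \<Longrightarrow> \<bar>x\<bar> \<le> 1 / 2 \<Longrightarrow>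
       \<bar>laplace_fun v n x - laplace_approx v K n x\<bar> \<le> B * \<bar>x\<bar> ^ K * exp (- (real n * x\<^sup>2 / 12))"
proof -
  have "\<forall>k. \<exists>B. B \<ge> 0 \<and> (\<forall>x. \<bar>x\<bar> \<le> 1 / 2 \<longrightarrow> \<bar>eval_fps phase_fps x ^ k * (1 + x) powr real_of_int v
        - (\<Sum>m<K. laplace_coeff v k m * x ^ m)\<bar> \<le> B * \<bar>x\<bar> ^ K)"
    by (metis laplace_coeff_taylor)
  then obtain C where C: "\<And>k. C k \<ge> 0" "\<And>k x. \<bar>x\<bar> \<le> 1 / 2 \<Longrightarrow>
      \<bar>eval_fps phase_fps x ^ k * (1 + x) powr real_of_int v - (\<Sum>m<K. laplace_coeff v k m * x ^ m)\<bar> \<le> C k * \<bar>x\<bar> ^ K"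
    by metis
  \<comment> \<open>The series of \<open>w(x) ^ K\<close> starts at order \<open>K\<close>, so the
    first \<open>K\<close> Taylor coefficients vanish and the remainder is the function
    itself.\<close>
  obtain D where D: "D \<ge> 0" "\<And>x. \<bar>x\<bar> \<le> 1 / 2 \<Longrightarrow> 
      \<bar>eval_fps phase_fps x ^ K * (1 + x) powr real_of_int v\<bar> \<le> D * \<bar>x\<bar> ^ K"
  proof -
    have z: "laplace_coeff v K m = 0" if "m < K" for m
    proof -
      have "fps_nth (phase_fps ^ K) i = 0" if "i < K" for i
        using startsby_zero_power_prefix[of phase_fps K] that by (auto simp: phase_fps_def)
      then show ?thesis using that by (auto simp: laplace_coeff_def fps_mult_nth intro!: sum.neutral)
    qed
    show ?thesis
      by (rule laplace_coeff_taylor[of K v K], rule that) (auto simp: z)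
  qed
  define B where "B = D * 12 ^ K + (\<Sum>k<K. C k * 12 ^ k)"
  show ?thesis
  proof (rule that[of B])
    show "B \<ge> 0" using C(1) D(1) by (auto simp: B_def intro!: add_nonneg_nonneg sum_nonneg)
    fix n x assume n: "int n + v \<ge> 0" and x: "\<bar>x :: real\<bar> \<le> 1 / 2"
    define w where "w = eval_fps phase_fps x"
    define p where "p = (1 + x) powr real_of_int v"
    define t where "t = real n * x\<^sup>2"
    have t: "t \<ge> 0" by (simp add: t_def)
    have w: "\<bar>w\<bar> \<le> 1 / 3" unfolding w_def by (rule eval_phase_fps_bound[OF x])
    have p: "p \<ge> 0" by (simp add: p_def)
    have L: "laplace_fun v n x = exp (- (t / 2)) * exp (t * w) * p"
      using laplace_eq_gaussian[of x n v] n x by (simp add: t_def w_def p_def)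
    \<comment> \<open>The decay is split into two equal halves: one absorbs \<open>t ^ k\<close>,
      the other survives.\<close>
    have E: "t ^ k / fact k * exp (- (t / 6)) \<le> 12 ^ k * exp (- (t / 12))" for k
    proof -
      have "t ^ k / fact k * exp (- (t / 6)) = (t ^ k * exp (- (t / 12))) * exp (- (t / 12)) / fact k"
        by (simp add: exp_add[symmetric] mult.assoc)
      also have "\<dots> \<le> (12 ^ k * fact k) * exp (- (t / 12)) / fact k"
        by (intro divide_right_mono mult_right_mono power_times_exp_bound t) auto
      finally show ?thesis by simp
    qed
    \<comment> \<open>Lagrange remainder, with intermediate point
      \<open>s \<le> \<bar>t * w\<bar> \<le> t / 3\<close>.\<close>
    have "\<bar>exp (t * w) - (\<Sum>k<K. (t * w) ^ k / fact k)\<bar> \<le> exp (t / 3) / fact K * (t * \<bar>w\<bar>) ^ K"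
    proof -
      obtain s where s: "\<bar>s\<bar> \<le> \<bar>t * w\<bar>" "exp (t * w) = (\<Sum>k<K. (t * w) ^ k / fact k) + exp s / fact K * (t * w) ^ K"
        using Maclaurin_exp_le by blast
      have "s \<le> \<bar>t * w\<bar>" using s by simp
      also have "\<dots> \<le> t * (1 / 3)" unfolding abs_mult using t w by (intro mult_mono) auto
      finally have "exp s \<le> exp (t / 3)" by simp
      then have "exp s / fact K * (t * \<bar>w\<bar>) ^ K \<le> exp (t / 3) / fact K * (t * \<bar>w\<bar>) ^ K"
        using t by (intro mult_right_mono divide_right_mono) auto
      then show ?thesis using s(2) t by (simp add: abs_mult power_abs)
    qed
    then have "exp (- (t / 2)) * p * \<bar>exp (t * w) - (\<Sum>k<K. (t * w) ^ k / fact k)\<bar>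
        \<le> exp (- (t / 2)) * p * (exp (t / 3) / fact K * (t * \<bar>w\<bar>) ^ K)"
      by (intro mult_left_mono) (use p in auto)
    also have "\<dots> = (exp (- (t / 2)) * exp (t / 3)) * (t ^ K / fact K) * \<bar>w ^ K * p\<bar>"
      using p by (simp add: abs_mult power_abs power_mult_distrib)
    also have "exp (- (t / 2)) * exp (t / 3) = exp (- (t / 6))" by (simp add: exp_add[symmetric])
    also have "exp (- (t / 6)) * (t ^ K / fact K) * \<bar>w ^ K * p\<bar> = (t ^ K / fact K * exp (- (t / 6))) * \<bar>w ^ K * p\<bar>"
      by (simp only: mult_ac)
    also have "\<dots> \<le> (12 ^ K * exp (- (t / 12))) * (D * \<bar>x\<bar> ^ K)"
      by (rule mult_mono[OF E]) (use D(2)[OF x] in \<open>auto simp: w_def p_def\<close>)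
    finally have 1: "exp (- (t / 2)) * p * \<bar>exp (t * w) - (\<Sum>k<K. (t * w) ^ k / fact k)\<bar>
        \<le> (12 ^ K * exp (- (t / 12))) * (D * \<bar>x\<bar> ^ K)" .
    define q where "q = (\<lambda>k. \<Sum>m<K. laplace_coeff v k m * x ^ m)"
    have A: "laplace_approx v K n x = exp (- (t / 2)) * (\<Sum>k<K. t ^ k / fact k * q k)"
      by (simp add: laplace_approx_def t_def q_def power_mult_distrib power_mult)
    have e: "exp (- (t / 2)) \<le> exp (- (t / 6))" using t by simp
    have "\<bar>exp (- (t / 2)) * (\<Sum>k<K. t ^ k / fact k * (w ^ k * p - q k))\<bar>
        \<le> exp (- (t / 2)) * (\<Sum>k<K. \<bar>t ^ k / fact k * (w ^ k * p - q k)\<bar>)"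
      unfolding abs_mult[of "exp (- (t / 2))"] abs_exp_cancel by (intro mult_left_mono sum_abs) simp
    also have "\<dots> \<le> exp (- (t / 6)) * (\<Sum>k<K. t ^ k / fact k * (C k * \<bar>x\<bar> ^ K))"
      using e C(2)[OF x] t unfolding q_def w_def p_def
      by (intro mult_mono sum_mono) (auto simp: abs_mult intro!: mult_left_mono sum_nonneg divide_right_mono)
    also have "\<dots> = (\<Sum>k<K. (t ^ k / fact k * exp (- (t / 6))) * (C k * \<bar>x\<bar> ^ K))"
      by (simp add: sum_distrib_left mult_ac)
    also have "\<dots> \<le> (\<Sum>k<K. (12 ^ k * exp (- (t / 12))) * (C k * \<bar>x\<bar> ^ K))"
      by (intro sum_mono mult_right_mono E) (use C(1) in auto)
    finally have 2: "\<bar>exp (- (t / 2)) * (\<Sum>k<K. t ^ k / fact k * (w ^ k * p - q k))\<bar>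
        \<le> (\<Sum>k<K. (12 ^ k * exp (- (t / 12))) * (C k * \<bar>x\<bar> ^ K))" .
    \<comment> \<open>The intermediate expression has the exponential series cut but keeps each
      \<open>w ^ k * p\<close> exact.\<close>
    have "laplace_fun v n x - laplace_approx v K n x = exp (- (t / 2)) * p * (exp (t * w) - (\<Sum>k<K. (t * w) ^ k / fact k))
         + exp (- (t / 2)) * (\<Sum>k<K. t ^ k / fact k * (w ^ k * p - q k))"
      by (simp add: L A algebra_simps sum_subtractf sum_distrib_left power_mult_distrib)
    then have "\<bar>laplace_fun v n x - laplace_approx v K n x\<bar> \<le> exp (- (t / 2)) * p * \<bar>exp (t * w) - (\<Sum>k<K. (t * w) ^ k / fact k)\<bar>
         + \<bar>exp (- (t / 2)) * (\<Sum>k<K. t ^ k / fact k * (w ^ k * p - q k))\<bar>"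
      using p by (auto simp: abs_mult intro: order_trans[OF abs_triangle_ineq])
    also have "\<dots> \<le> (12 ^ K * exp (- (t / 12))) * (D * \<bar>x\<bar> ^ K) + (\<Sum>k<K. (12 ^ k * exp (- (t / 12))) * (C k * \<bar>x\<bar> ^ K))"
      by (intro add_mono 1 2)
    also have "\<dots> = B * \<bar>x\<bar> ^ K * exp (- (t / 12))"
      by (simp add: B_def algebra_simps sum_distrib_left sum_distrib_right)
    finally show "\<bar>laplace_fun v n x - laplace_approx v K n x\<bar> \<le> B * \<bar>x\<bar> ^ K * exp (- (real n * x\<^sup>2 / 12))"
      by (simp add: t_def)
  qed
qed

subsection \<open>Principal values\<close>

lemma set_integral_abs_le:
  fixes f g :: "'a \<Rightarrow> real"
  assumes "set_integrable M A f" "set_integrable M A g" "\<And>x. x \<in> A \<Longrightarrow> \<bar>f x\<bar> \<le> g x"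
  shows "\<bar>LINT x:A|M. f x\<bar> \<le> (LINT x:A|M. g x)"
proof -
  have "(LINT x:A|M. f x) \<le> (LINT x:A|M. g x)"
    using assms by (intro set_integral_mono) force+
  moreover have "(LINT x:A|M. - g x) \<le> (LINT x:A|M. f x)"
    using assms by (intro set_integral_mono) (force simp: set_integrable_def)+
  ultimately show ?thesis using assms(2) by (simp add: set_integral_uminus)
qed

lemma
  fixes f :: "'i \<Rightarrow> 'a \<Rightarrow> real"
  assumes "\<And>i. i \<in> I \<Longrightarrow> set_integrable M A (f i)"
  shows set_integrable_sum: "set_integrable M A (\<lambda>x. \<Sum>i\<in>I. f i x)"
    and set_integral_sum: "(LINT x:A|M. \<Sum>i\<in>I. f i x) = (\<Sum>i\<in>I. LINT x:A|M. f i x)"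
  using assms unfolding set_integrable_def set_lebesgue_integral_def scaleR_sum_right
  by (auto intro!: Bochner_Integration.integrable_sum Bochner_Integration.integral_sum)

lemma set_lborel_integral_reflect:
  fixes f :: "real \<Rightarrow> real"
  shows "(LBINT x:A. f x) = (LBINT x:uminus -` A. f (- x))"
  unfolding set_lebesgue_integral_def
  by (subst lborel_integral_real_affine[of "-1" _ 0]) (auto simp: indicator_def)

lemma set_lborel_integrable_reflect:
  fixes f :: "real \<Rightarrow> real"
  assumes "set_integrable lborel A f"
  shows "set_integrable lborel (uminus -` A) (\<lambda>x. f (- x))"
  using lborel_integrable_real_affine[of "\<lambda>x. indicator A x *\<^sub>R f x" "-1" 0] assms
  unfolding set_integrable_def by (auto simp: indicator_def)

text \<open>
  The principal value at \<open>0\<close> of an integral over \<open>(-1, \<infinity>)\<close>: near the singularity the integrand is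
  folded, so that only absolutely convergent integrals occur. The cut at \<open>1/2\<close> is arbitrary.
\<close>

definition pv_integrable :: "(real \<Rightarrow> real) \<Rightarrow> bool" where
  "pv_integrable k \<longleftrightarrow> set_integrable lborel {0<..1/2} (\<lambda>x. k x + k (- x)) \<and>
     set_integrable lborel {1/2<..} k \<and> set_integrable lborel {-1<..<-(1/2)} k"

definition pv :: "(real \<Rightarrow> real) \<Rightarrow> real" where
  "pv k = (LBINT x:{0<..1/2}. k x + k (- x)) + (LBINT x:{1/2<..}. k x) + (LBINT x:{-1<..<-(1/2)}. k x)"

lemma pv_diff:
  assumes "pv_integrable f" "pv_integrable g"
  shows "pv_integrable (\<lambda>x. f x - g x)" "pv (\<lambda>x. f x - g x) = pv f - pv g"
proof -
  have e: "(\<lambda>x. f x - g x + (f (- x) - g (- x))) = (\<lambda>x. (f x + f (- x)) - (g x + g (- x)))"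
    by (simp add: fun_eq_iff)
  show "pv_integrable (\<lambda>x. f x - g x)"
    using assms unfolding pv_integrable_def e by (intro conjI set_integral_diff) auto
  show "pv (\<lambda>x. f x - g x) = pv f - pv g"
    using assms unfolding pv_integrable_def pv_def e by (simp only: set_integral_diff)
qed

text \<open>None of the ranges, nor the reflected one, contains 0, so the conventional value of a
  quotient at its pole never matters.\<close>

lemma pv_cong:
  assumes "\<And>x. x \<noteq> 0 \<Longrightarrow> f x = g x"
  shows "pv_integrable f = pv_integrable g" "pv f = pv g"
  unfolding pv_integrable_def pv_def
  by (intro conj_cong arg_cong2[of _ _ _ _ "(+)"] set_lebesgue_integral_cong set_integrable_cong;
      use assms in auto)+

text \<open>Absolute integrability allows unfolding: the part on \<open>{-(1/2)..<0}\<close> is the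
  reflection of the right half, and the point 0 is null.\<close>

lemma pv_eq_integral:
  assumes "set_integrable lborel {-1<..} k"
  shows "pv_integrable k" "pv k = (LBINT x:{-1<..}. k x)"
proof -
  have sub: "set_integrable lborel A k" if "A \<subseteq> {-1<..}" "A \<in> sets lborel" for A
    using set_integrable_subset[OF assms that(2,1)] .
  let ?A = "{-1<..<-(1/2)::real}" and ?B = "{-(1/2)..<0::real}" and ?D = "{0<..1/2::real}" and ?E = "{1/2<..}::real set"
  have i: "set_integrable lborel ?A k" "set_integrable lborel ?B k" "set_integrable lborel {0} k"
      "set_integrable lborel ?D k" "set_integrable lborel ?E k"
    by (auto intro!: sub)
  have v: "uminus -` ?B = ?D" by auto
  have r: "set_integrable lborel ?D (\<lambda>x. k (- x))"
    using set_lborel_integrable_reflect[OF i(2)] unfolding v .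
  show "pv_integrable k" using i r unfolding pv_integrable_def by auto
  have z: "(LBINT x:{0}. k x) = 0"
    by (subst set_integral_at_point) (use i(3) in auto)
  have "{-1<..} = (((?A \<union> ?B) \<union> {0}) \<union> ?D) \<union> ?E" by auto
  also have "(LBINT x:\<dots>. k x) = (LBINT x:?A. k x) + (LBINT x:?B. k x) + (LBINT x:{0}. k x) 
      + (LBINT x:?D. k x) + (LBINT x:?E. k x)"
    by (subst set_integral_Un, (force intro!: sub simp: i)+)+
  also have "(LBINT x:?B. k x) = (LBINT x:?D. k (- x))"
    by (subst set_lborel_integral_reflect) (simp add: v)
  finally show "pv k = (LBINT x:{-1<..}. k x)"
    using i r by (simp add: pv_def z)
qed

text \<open>Cutting out a symmetric neighbourhood of 0 shortens the folded integral to
  \<open>{\<eta>..1/2}\<close>, which converges because the folded integrand is integrable. The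
  hypotheses \<open>loc\<close> allow unfolding it for each fixed \<open>\<eta>\<close>.\<close>

lemma pv_tendsto:
  assumes k: "pv_integrable k"
    and loc: "\<And>\<eta>. 0 < \<eta> \<Longrightarrow> set_integrable lborel {\<eta>..1/2} k"
      "\<And>\<eta>. 0 < \<eta> \<Longrightarrow> set_integrable lborel {-(1/2)..-\<eta>} k"
  shows "((\<lambda>\<eta>. (LBINT x:{\<eta><..}. k x) + (LBINT x:{-1<..<-\<eta>}. k x)) \<longlongrightarrow> pv k) (at_right 0)"
proof -
  have ev: "eventually (\<lambda>\<eta>. \<eta> \<in> {0<..<1/2::real}) (at_right 0)"
    by (rule eventually_at_right_real) simp
  have "((\<lambda>\<eta>. (LBINT x:{\<eta>..1/2}. k x + k (- x)) + (LBINT x:{1/2<..}. k x) + (LBINT x:{-1<..<-(1/2)}. k x))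
      \<longlongrightarrow> pv k) (at_right 0)"
    unfolding pv_def using k
    by (intro tendsto_add tendsto_const tendsto_set_lebesgue_integral_at_right) (auto simp: pv_integrable_def)
  then show ?thesis
  proof (rule Lim_transform_eventually)
    show "eventually (\<lambda>\<eta>. (LBINT x:{\<eta>..1/2}. k x + k (- x)) + (LBINT x:{1/2<..}. k x) + (LBINT x:{-1<..<-(1/2)}. k x)
       = (LBINT x:{\<eta><..}. k x) + (LBINT x:{-1<..<-\<eta>}. k x)) (at_right 0)"
      using ev
    proof eventually_elim
      case (elim \<eta>)
      have i: "set_integrable lborel {\<eta><..1/2} k" "set_integrable lborel {-(1/2)..<-\<eta>} k"
         "set_integrable lborel {1/2<..} k" "set_integrable lborel {-1<..<-(1/2)} k"
        using set_integrable_subset[OF loc(1)[of \<eta>], of "{\<eta><..1/2}"]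
          set_integrable_subset[OF loc(2)[of \<eta>], of "{-(1/2)..<-\<eta>}"] elim k
        by (auto simp: pv_integrable_def subset_eq)
      have v: "uminus -` {-(1/2)..<-\<eta>} = {\<eta><..1/2}" by auto
      have r: "set_integrable lborel {\<eta><..1/2} (\<lambda>x. k (- x))"
        using set_lborel_integrable_reflect[OF i(2)] unfolding v .
      have "{\<eta><..} = {\<eta><..1/2} \<union> {1/2<..}" using elim by auto
      also have "(LBINT x:\<dots>. k x) = (LBINT x:{\<eta><..1/2}. k x) + (LBINT x:{1/2<..}. k x)"
        by (subst set_integral_Un) (use i in auto)
      finally have 1: "(LBINT x:{\<eta><..}. k x) = (LBINT x:{\<eta><..1/2}. k x) + (LBINT x:{1/2<..}. k x)" .
      have "{-1<..<-\<eta>} = {-1<..<-(1/2)} \<union> {-(1/2)..<-\<eta>}" using elim by auto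
      also have "(LBINT x:\<dots>. k x) = (LBINT x:{-1<..<-(1/2)}. k x) + (LBINT x:{-(1/2)..<-\<eta>}. k x)"
        by (subst set_integral_Un) (use i in auto)
      also have "(LBINT x:{-(1/2)..<-\<eta>}. k x) = (LBINT x:{\<eta><..1/2}. k (- x))"
        by (subst set_lborel_integral_reflect) (simp add: v)
      finally have 2: "(LBINT x:{-1<..<-\<eta>}. k x) = (LBINT x:{-1<..<-(1/2)}. k x) + (LBINT x:{\<eta><..1/2}. k (- x))" .
      \<comment> \<open>The two ranges differ only in the null set \<open>{\<eta>}\<close>.\<close>
      have "(LBINT x:{\<eta>..1/2}. k x + k (- x)) = (LBINT x:{\<eta><..1/2}. k x + k (- x))"
        by (rule set_integral_discrete_difference[where X="{\<eta>}"]) auto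
      also have "\<dots> = (LBINT x:{\<eta><..1/2}. k x) + (LBINT x:{\<eta><..1/2}. k (- x))"
        using i r by simp
      finally show ?case using 1 2 by simp
    qed
  qed
qed

subsection \<open>Gaussian moments\<close>

text \<open>The moment for \<open>exp (- x\<^sup>2)\<close> is rescaled by \<open>sqrt a\<close>;
  the factor \<open>1 / a ^ i\<close> then removes the scaling from the power.\<close>

lemma gaussian_moment_pos:
  fixes a :: real
  assumes "a > 0"
  shows "has_bochner_integral lborel (\<lambda>x. indicator {0<..} x *\<^sub>R (x ^ (2 * i) * exp (- (a * x\<^sup>2))))
     (sqrt pi / 2 * (fact (2 * i) / (4 ^ i * fact i)) / (a ^ i * sqrt a))"
proof -
  have "has_bochner_integral lborel (\<lambda>x::real. indicator {0<..} x *\<^sub>R (exp (- x\<^sup>2) * x ^ (2 * i)))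
       (sqrt pi / 2 * (fact (2 * i) / (2 ^ (2 * i) * fact i)))"
  proof -
    have "AE x in lborel. indicator {0..} x *\<^sub>R (exp (- x\<^sup>2) * x ^ (2 * i)) =
        (indicator {0<..} x *\<^sub>R (exp (- x\<^sup>2) * x ^ (2 * i)) :: real)"
      using AE_lborel_singleton[of 0] by eventually_elim (auto simp: indicator_def)
    from has_bochner_integral_cong_AE[THEN iffD1, OF _ _ this gaussian_moment_even_pos]
    show ?thesis by simp
  qed
  then have "has_bochner_integral lborel (\<lambda>x::real. indicator {0<..} (0 + sqrt a * x) *\<^sub>R (exp (- (0 + sqrt a * x)\<^sup>2) * (0 + sqrt a * x) ^ (2 * i)))
       ((sqrt pi / 2 * (fact (2 * i) / (2 ^ (2 * i) * fact i))) /\<^sub>R \<bar>sqrt a\<bar>)"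
    using assms by (subst (asm) lborel_has_bochner_integral_real_affine_iff[of "sqrt a" _ _ 0]) auto
  then have "has_bochner_integral lborel (\<lambda>x::real. (indicator {0<..} (0 + sqrt a * x) *\<^sub>R (exp (- (0 + sqrt a * x)\<^sup>2) * (0 + sqrt a * x) ^ (2 * i))) * (1 / a ^ i))
       (((sqrt pi / 2 * (fact (2 * i) / (2 ^ (2 * i) * fact i))) /\<^sub>R \<bar>sqrt a\<bar>) * (1 / a ^ i))"
    by (intro has_bochner_integral_mult_left) auto
  also have "(\<lambda>x::real. (indicator {0<..} (0 + sqrt a * x) *\<^sub>R (exp (- (0 + sqrt a * x)\<^sup>2) * (0 + sqrt a * x) ^ (2 * i))) * (1 / a ^ i))
     = (\<lambda>x. indicator {0<..} x *\<^sub>R (x ^ (2 * i) * exp (- (a * x\<^sup>2))))"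
    using assms by (auto simp: fun_eq_iff indicator_def zero_less_mult_iff power_mult_distrib power_mult)
  also have "((sqrt pi / 2 * (fact (2 * i) / (2 ^ (2 * i) * fact i))) /\<^sub>R \<bar>sqrt a\<bar>) * (1 / a ^ i)
     = sqrt pi / 2 * (fact (2 * i) / (4 ^ i * fact i)) / (a ^ i * sqrt a)"
    using assms unfolding power_mult by (simp add: field_simps)
  finally show ?thesis .
qed

text \<open>For \<open>a > 0\<close>, the integral of
  \<open>x ^ (2 * i) * exp (- (a * x\<^sup>2))\<close> over \<open>x > 0\<close>.\<close>

definition half_gaussian_moment :: "nat \<Rightarrow> real \<Rightarrow> real" where
  "half_gaussian_moment i a = sqrt pi / 2 * (fact (2 * i) / (4 ^ i * fact i)) / (a ^ i * sqrt a)"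

text \<open>On the tail \<open>x > 1 / 2\<close> one has \<open>1 \<le> (2 * x) ^ (2 * R)\<close>,
  so the tail is at most \<open>4 ^ R\<close> times a moment of index \<open>i + R\<close>, which is
  smaller by the order \<open>a ^ R\<close>. This suffices for an expansion to order
  \<open>R\<close>.\<close>

lemma gaussian_moment_truncated:
  fixes a :: real
  assumes "a > 0"
  shows "set_integrable lborel {0<..1/2} (\<lambda>x. x ^ (2 * i) * exp (- (a * x\<^sup>2)))"
    and "(LBINT x:{0<..1/2}. x ^ (2 * i) * exp (- (a * x\<^sup>2))) \<le> half_gaussian_moment i a"
    and "\<bar>(LBINT x:{0<..1/2}. x ^ (2 * i) * exp (- (a * x\<^sup>2))) - half_gaussian_moment i a\<bar> \<le> 4 ^ R * half_gaussian_moment (i + R) a"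
proof -
  let ?f = "\<lambda>i x. x ^ (2 * i) * exp (- (a * x\<^sup>2))"
  have int: "set_integrable lborel {0<..} (?f i)" and val: "(LBINT x:{0<..}. ?f i x) = half_gaussian_moment i a" for i
    using gaussian_moment_pos[OF assms, of i]
    by (auto simp: set_integrable_def set_lebesgue_integral_def half_gaussian_moment_def has_bochner_integral_iff)
  have sub: "set_integrable lborel A (?f i)" if "A \<subseteq> {0<..}" "A \<in> sets lborel" for A i
    using set_integrable_subset[OF int that(2,1)] .
  show "set_integrable lborel {0<..1/2} (?f i)" by (rule sub) auto
  have split: "half_gaussian_moment i a = (LBINT x:{0<..1/2}. ?f i x) + (LBINT x:{1/2<..}. ?f i x)" for i
  proof -
    have "{0<..} = {0<..1/2} \<union> ({1/2<..} :: real set)" by auto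
    also have "(LBINT x:\<dots>. ?f i x) = (LBINT x:{0<..1/2}. ?f i x) + (LBINT x:{1/2<..}. ?f i x)"
      by (intro set_integral_Un sub) auto
    finally show ?thesis by (simp add: val)
  qed
  have nn: "(LBINT x:A. ?f i x) \<ge> 0" for A i
    unfolding set_lebesgue_integral_def by (intro integral_nonneg_AE) auto
  show "(LBINT x:{0<..1/2}. ?f i x) \<le> half_gaussian_moment i a" using split[of i] nn[of "{1/2<..}" i] by simp
  have "(LBINT x:{1/2<..}. ?f i x) \<le> (LBINT x:{1/2<..}. 4 ^ R * ?f (i + R) x)"
  proof (intro set_integral_mono set_integrable_mult_right sub impI)
    fix x :: real assume x: "x \<in> {1/2<..}"
    have "1 \<le> (2 * x) ^ (2 * R)" using x by (intro one_le_power) auto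
    then have "1 \<le> 4 ^ R * x ^ (2 * R)" by (simp add: power_mult power_mult_distrib)
    then have "?f i x * 1 \<le> ?f i x * (4 ^ R * x ^ (2 * R))"
      by (intro mult_left_mono) auto
    then show "?f i x \<le> 4 ^ R * ?f (i + R) x"
      by (simp add: power_add distrib_left mult_ac)
  qed auto
  also have "\<dots> = 4 ^ R * (LBINT x:{1/2<..}. ?f (i + R) x)" by simp
  also have "\<dots> \<le> 4 ^ R * half_gaussian_moment (i + R) a"
    using split[of "i + R"] nn[of "{0<..1/2}" "i + R"] by (intro mult_left_mono) auto
  finally show "\<bar>(LBINT x:{0<..1/2}. ?f i x) - half_gaussian_moment i a\<bar> \<le> 4 ^ R * half_gaussian_moment (i + R) a"
    using split[of i] nn[of "{1/2<..}" i] by simp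
qed

lemma fact_double_dfact: "fact (2 * i) = 2 ^ i * fact i * real (dfact (2 * i - 1))"
proof (induction i)
  case (Suc i)
  show ?case
  \<comment> \<open>For \<open>i = 0\<close> truncated subtraction makes \<open>2 * i - 1\<close>
    zero, so the recurrence step by two is available only for \<open>i > 0\<close>.\<close>
  proof (cases i)
    case (Suc j)
    then have "2 * Suc i - 1 = Suc (Suc (2 * i - 1))" by simp
    then have "real (dfact (2 * Suc i - 1)) = real (2 * i + 1) * real (dfact (2 * i - 1))"
      using Suc by (simp add: algebra_simps)
    with Suc.IH show ?thesis by (simp add: algebra_simps)
  qed simp
qed simp

text \<open>\<open>a = n / 2\<close> belongs to the Gaussian of \<open>laplace_approx\<close>; here
  the double factorials of \<open>inner_sum\<close> appear.\<close>

lemma half_gaussian_moment_eq_dfact: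
  assumes "n \<ge> 1"
  shows "half_gaussian_moment i (real n / 2) = sqrt (2 * pi) / 2 * real (dfact (2 * i - 1)) / (real n ^ i * sqrt (real n))"
proof -
  have "fact (2 * i) / (4 ^ i * fact i) = real (dfact (2 * i - 1)) / 2 ^ i"
    unfolding fact_double_dfact using power_mult_distrib[of "2::real" 2 i] by simp
  moreover have "(real n / 2) ^ i * sqrt (real n / 2) = real n ^ i * sqrt (real n) / (2 ^ i * sqrt 2)"
    by (simp add: power_divide real_sqrt_divide)
  ultimately show ?thesis
    unfolding half_gaussian_moment_def by (simp add: real_sqrt_mult)
qed

text \<open>The substitution \<open>y = n * (1 + x)\<close> gives Euler's integral for
  \<open>fact j\<close>. It evaluates both the denominator and the terms of the geometric
  sum.\<close>

lemma shifted_Gamma_integral: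
  assumes "n \<ge> 1"
  shows "set_integrable lborel {-1<..} (\<lambda>x. (1 + x) ^ j * exp (- (real n * x)))"
    and "(LBINT x:{-1<..}. (1 + x) ^ j * exp (- (real n * x))) = exp (real n) * fact j / real n ^ (j + 1)"
proof -
  let ?g = "\<lambda>x::real. x ^ j * exp (- x) * indicator {0<..} x"
  have "has_bochner_integral lborel (\<lambda>x. ?g (real n + real n * x)) (fact j /\<^sub>R \<bar>real n\<bar>)"
    using has_bochner_integral_I0i_power_exp_m[of j] assms
    by (subst (asm) lborel_has_bochner_integral_real_affine_iff[of "real n" _ _ "real n"]) auto
  then have "has_bochner_integral lborel (\<lambda>x. ?g (real n + real n * x) * (exp (real n) / real n ^ j))
      ((fact j /\<^sub>R \<bar>real n\<bar>) * (exp (real n) / real n ^ j))"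
    by (intro has_bochner_integral_mult_left) auto
  also have "(\<lambda>x. ?g (real n + real n * x) * (exp (real n) / real n ^ j))
      = (\<lambda>x. indicator {-1<..} x *\<^sub>R ((1 + x) ^ j * exp (- (real n * x))))"
  proof
    fix x :: real
    have p: "real n + real n * x = real n * (1 + x)" by (simp add: algebra_simps)
    have e: "exp (- (real n * x)) = exp (- (real n * (1 + x))) * exp (real n)"
      by (simp add: exp_add[symmetric] algebra_simps)
    have "0 < real n * (1 + x) \<longleftrightarrow> -1 < x" using assms by (auto simp: zero_less_mult_iff)
    then show "?g (real n + real n * x) * (exp (real n) / real n ^ j) = indicator {-1<..} x *\<^sub>R ((1 + x) ^ j * exp (- (real n * x)))"
      using assms unfolding p e by (simp add: indicator_def power_mult_distrib)
  qed
  also have "(fact j /\<^sub>R \<bar>real n\<bar>) * (exp (real n) / real n ^ j) = exp (real n) * fact j / real n ^ (j + 1)"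
    by (simp add: field_simps)
  finally show "set_integrable lborel {-1<..} (\<lambda>x. (1 + x) ^ j * exp (- (real n * x)))"
     "(LBINT x:{-1<..}. (1 + x) ^ j * exp (- (real n * x))) = exp (real n) * fact j / real n ^ (j + 1)"
    by (auto simp: set_integrable_def set_lebesgue_integral_def has_bochner_integral_iff)
qed

subsection \<open>Integrability and decay\<close>

text \<open>From \<open>exp x \<ge> (1 + x / 2)\<^sup>2 = 1 + x + x\<^sup>2 / 4\<close> and, for
  these \<open>x\<close>, \<open>6 * x\<^sup>2 \<ge> 1 + x\<close>, one gets
  \<open>exp x \<ge> (25 / 24) * (1 + x)\<close>.\<close>

lemma one_plus_times_exp_le:
  fixes x :: real
  assumes "x > -1" "\<bar>x\<bar> \<ge> 1 / 2"
  shows "(1 + x) * exp (- x) \<le> 24 / 25"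
proof -
  have "(1 + x / 2)\<^sup>2 \<le> exp (x / 2) ^ 2"
    using assms by (intro power_mono exp_ge_add_one_self) auto
  also have "exp (x / 2) ^ 2 = exp x" by (simp add: power2_eq_square exp_add[symmetric])
  finally have e: "1 + x + x\<^sup>2 / 4 \<le> exp x" by (simp add: power2_eq_square field_simps)
  have "(1 / 2)\<^sup>2 \<le> x\<^sup>2" using assms(2) power_mono[of "1/2" "\<bar>x\<bar>" 2] by simp
  moreover have "0 \<le> (2 * x - 1)\<^sup>2" by simp
  ultimately have "1 + x \<le> 6 * x\<^sup>2" by (simp add: power2_eq_square algebra_simps)
  with e have "25 * (1 + x) \<le> 24 * exp x" by simp
  then show ?thesis by (simp add: exp_minus field_simps)
qed

lemma laplace_nonneg: "x > -1 \<Longrightarrow> laplace_fun v n x \<ge> 0"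
  by (simp add: laplace_fun_def)

text \<open>Each increase of \<open>n\<close> by one multiplies the integrand by
  \<open>(1 + x) * exp (- x)\<close>, so it decays geometrically relative to one fixed
  function.\<close>

lemma laplace_outside_bound:
  assumes "n\<^sub>0 \<le> n" "int n\<^sub>0 + v \<ge> 0" "x > -1" "\<bar>x\<bar> \<ge> 1 / 2"
  shows "laplace_fun v n x \<le> (24 / 25) ^ (n - n\<^sub>0) * laplace_fun v n\<^sub>0 x"
proof -
  have 1: "nat (int n + v) = (n - n\<^sub>0) + nat (int n\<^sub>0 + v)" using assms by simp
  have 2: "exp (- (real n * x)) = exp (- x) ^ (n - n\<^sub>0) * exp (- (real n\<^sub>0 * x))"
    using assms(1) by (simp add: exp_of_nat_mult[symmetric] exp_add[symmetric] of_nat_diff algebra_simps)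
  have "laplace_fun v n x = ((1 + x) * exp (- x)) ^ (n - n\<^sub>0) * laplace_fun v n\<^sub>0 x"
    unfolding laplace_fun_def 1 2 by (simp add: power_add power_mult_distrib)
  also have "\<dots> \<le> (24 / 25) ^ (n - n\<^sub>0) * laplace_fun v n\<^sub>0 x"
    using assms by (intro mult_right_mono power_mono one_plus_times_exp_le laplace_nonneg) auto
  finally show ?thesis .
qed

lemma laplace_measurable [measurable]: "laplace_fun v n \<in> borel_measurable borel"
  unfolding laplace_fun_def by measurable

lemma laplace_set_integrable: "n \<ge> 1 \<Longrightarrow> set_integrable lborel {-1<..} (laplace_fun v n)"
  using shifted_Gamma_integral(1)[of n "nat (int n + v)"] by (simp add: laplace_fun_def[abs_def])

lemma laplace_div_bound:
  assumes "s \<le> 1" "x > -1" "\<bar>x\<bar> \<ge> 1 / 2"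
  shows "\<bar>laplace_fun v n x / x ^ s\<bar> \<le> 2 * laplace_fun v n x"
proof -
  from assms(1) consider "s = 0" | "s = 1" by linarith
  then show ?thesis
  proof cases
    case 1
    then show ?thesis using laplace_nonneg[OF assms(2)] by simp
  next
    case 2
    have "laplace_fun v n x * 1 \<le> laplace_fun v n x * (2 * \<bar>x\<bar>)"
      using laplace_nonneg[OF assms(2), of v n] assms(3) by (intro mult_left_mono) auto
    then show ?thesis
      using 2 laplace_nonneg[OF assms(2), of v n] assms(3) by (simp add: field_simps)
  qed
qed

lemma laplace_div_set_integrable:
  assumes "n \<ge> 1" "s \<le> 1" "A \<in> sets borel" "A \<subseteq> {-1<..}" "\<And>x. x \<in> A \<Longrightarrow> \<bar>x\<bar> \<ge> 1 / 2"
  shows "set_integrable lborel A (\<lambda>x. laplace_fun v n x / x ^ s)"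
proof (rule set_integrable_bound)
  show "set_integrable lborel A (\<lambda>x. 2 * laplace_fun v n x)"
    using set_integrable_subset[OF laplace_set_integrable[OF assms(1), of v], of A] assms
    by (intro set_integrable_mult_right) auto
  show "set_borel_measurable lborel A (\<lambda>x. laplace_fun v n x / x ^ s)"
    using assms(3) unfolding set_borel_measurable_def by measurable
  show "AE x in lborel. x \<in> A \<longrightarrow> norm (laplace_fun v n x / x ^ s) \<le> norm (2 * laplace_fun v n x)"
  proof (intro AE_I2 impI)
    fix x assume "x \<in> A"
    then have "x > -1" "\<bar>x\<bar> \<ge> 1 / 2" using assms by auto
    from laplace_div_bound[OF assms(2) this, of v n] laplace_nonneg[OF this(1), of v n]
    show "norm (laplace_fun v n x / x ^ s) \<le> norm (2 * laplace_fun v n x)" by simp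
  qed
qed

text \<open>Only \<open>s = 1\<close> near 0 is delicate. The approximation of order 1 is even, so
  it cancels in the difference of the values at \<open>x\<close> and \<open>- x\<close>; what is
  left is at most \<open>2 * B * x\<close>, and the folded quotient is bounded.\<close>

lemma pv_integrable_laplace:
  assumes "n \<ge> 1" "int n + v \<ge> 0" "s \<le> 1"
  shows "pv_integrable (\<lambda>x. laplace_fun v n x / x ^ s)"
proof (cases "s = 0")
  case True
  then show ?thesis using pv_eq_integral(1)[OF laplace_set_integrable[OF assms(1)]] by simp
next
  case False
  then have s: "s = 1" using assms by simp
  obtain B where B: "B \<ge> 0" "\<And>n x. int n + v \<ge> 0 \<Longrightarrow> \<bar>x\<bar> \<le> 1 / 2 \<Longrightarrow>
       \<bar>laplace_fun v n x - laplace_approx v 1 n x\<bar> \<le> B * \<bar>x\<bar> ^ 1 * exp (- (real n * x\<^sup>2 / 12))"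
    using laplace_local_bound[of v 1] by blast
  have B': "\<bar>laplace_fun v n x - laplace_approx v 1 n x\<bar> \<le> B * \<bar>x\<bar>" if "\<bar>x\<bar> \<le> 1 / 2" for x
  proof -
    have "B * \<bar>x\<bar> * exp (- (real n * x\<^sup>2 / 12)) \<le> B * \<bar>x\<bar> * 1"
      using B(1) by (intro mult_left_mono) auto
    then show ?thesis using B(2)[OF assms(2) that] by simp
  qed
  have "set_integrable lborel {0<..1/2} (\<lambda>x. laplace_fun v n x / x + laplace_fun v n (- x) / (- x))"
  proof (rule set_integrable_bound)
    have "set_integrable lborel {0..1/2} (\<lambda>x::real. 2 * B)"
      by (rule borel_integrable_atLeastAtMost') auto
    then show "set_integrable lborel {0<..1/2} (\<lambda>x::real. 2 * B)"
      by (rule set_integrable_subset) auto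
    show "set_borel_measurable lborel {0<..1/2} (\<lambda>x. laplace_fun v n x / x + laplace_fun v n (- x) / (- x))"
      unfolding set_borel_measurable_def by measurable
    show "AE x in lborel. x \<in> {0<..1/2} \<longrightarrow> norm (laplace_fun v n x / x + laplace_fun v n (- x) / (- x)) \<le> norm (2 * B)"
    proof (intro AE_I2 impI)
      fix x :: real assume x: "x \<in> {0<..1/2}"
      have "laplace_approx v 1 n (- x) = laplace_approx v 1 n x" by (simp add: laplace_approx_def)
      then have "\<bar>laplace_fun v n x - laplace_fun v n (- x)\<bar> \<le> 2 * B * x"
        using B'[of x] B'[of "- x"] x by simp
      then show "norm (laplace_fun v n x / x + laplace_fun v n (- x) / (- x)) \<le> norm (2 * B)"
        using x B(1) by (simp add: field_simps diff_divide_distrib[symmetric])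
    qed
  qed
  then show ?thesis
    using laplace_div_set_integrable[OF assms(1), of 1 "{1/2<..}" v] laplace_div_set_integrable[OF assms(1), of 1 "{-1<..<-(1/2)}" v]
    by (auto simp: pv_integrable_def s subset_eq)
qed

subsection \<open>Expansion of the integrals\<close>

text \<open>Terms whose index has the parity of \<open>s\<close> double, the others cancel.\<close>

lemma sum_parity:
  fixes c :: "nat \<Rightarrow> real"
  assumes "s \<le> 1"
  shows "(\<Sum>m<2 * R + s. c m * (x ^ m + (-1) ^ s * (- x) ^ m)) = 2 * (\<Sum>r<R. c (2 * r + s) * x ^ (2 * r + s))"
proof -
  from assms consider "s = 0" | "s = 1" by linarith
  then show ?thesis by cases (induction R; simp add: algebra_simps)+
qed

text \<open>Folding selects the exponents with the parity of \<open>s\<close>, and dividing by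
  \<open>x ^ s\<close> makes them even, so only even Gaussian moments occur.\<close>

lemma laplace_approx_symmetrized:
  assumes "s \<le> 1" "x \<noteq> 0" "K = 2 * R + s"
  shows "laplace_approx v K n x / x ^ s + laplace_approx v K n (- x) / (- x) ^ s =
     (\<Sum>k<K. \<Sum>r<R. 2 * (real n ^ k / fact k * laplace_coeff v k (2 * r + s)) * (x ^ (2 * (k + r)) * exp (- (real n / 2 * x\<^sup>2))))"
proof -
  define e where "e = exp (- (real n / 2 * x\<^sup>2))"
  have sg: "(- x) ^ s = (-1) ^ s * x ^ s" by (rule power_minus)
  have "laplace_approx v K n x / x ^ s + laplace_approx v K n (- x) / (- x) ^ s =
     (laplace_approx v K n x + (-1) ^ s * laplace_approx v K n (- x)) / x ^ s"
    using assms unfolding sg by (cases "even s") (simp_all add: diff_divide_distrib add_divide_distrib)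
  also have "laplace_approx v K n x + (-1) ^ s * laplace_approx v K n (- x) =
     e * (\<Sum>k<K. real n ^ k / fact k * x ^ (2 * k) * (\<Sum>m<K. laplace_coeff v k m * (x ^ m + (-1) ^ s * (- x) ^ m)))"
    by (simp add: laplace_approx_def e_def sum_distrib_left sum_divide_distrib sum.distrib algebra_simps)
  also have "\<dots> = e * (\<Sum>k<K. real n ^ k / fact k * x ^ (2 * k) * (2 * (\<Sum>r<R. laplace_coeff v k (2 * r + s) * x ^ (2 * r + s))))"
    unfolding assms(3) sum_parity[OF assms(1)] ..
  also have "\<dots> / x ^ s = (\<Sum>k<K. \<Sum>r<R. 2 * (real n ^ k / fact k * laplace_coeff v k (2 * r + s)) * (x ^ (2 * (k + r)) * e))"
    using assms(2) by (simp add: sum_distrib_left sum_divide_distrib power_add distrib_left mult_ac)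
  finally show ?thesis unfolding e_def .
qed

text \<open>The exponent \<open>s\<close> is \<open>0\<close> for the denominator and \<open>1\<close> for the principal value in the numerator.\<close>

definition expansion_coeff :: "int \<Rightarrow> nat \<Rightarrow> nat \<Rightarrow> nat \<Rightarrow> real" where
  "expansion_coeff v K s r = (\<Sum>k<K. real (dfact (2 * (k + r) - 1)) / fact k * laplace_coeff v k (2 * r + s))"

text \<open>With \<open>K = 2 * R + s\<close> the local error divided by \<open>x ^ s\<close> is a
  multiple of \<open>x ^ (2 * R)\<close> times a Gaussian, whose integral is of order
  \<open>1 / (n ^ R * sqrt n)\<close>. The approximation itself integrates to truncated moments, and
  completing them costs no more.\<close>

lemma pv_laplace_local_expansion:
  assumes "s \<le> 1" "K = 2 * R + s"
  obtains C where "C \<ge> 0" "\<And>n. n \<ge> 1 \<Longrightarrow> int n + v \<ge> 0 \<Longrightarrow>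
    \<bar>sqrt (real n) * (LBINT x:{0<..1/2}. laplace_fun v n x / x ^ s + laplace_fun v n (- x) / (- x) ^ s)
       - sqrt (2 * pi) * (\<Sum>r<R. expansion_coeff v K s r / real n ^ r)\<bar> \<le> C / real n ^ R"
proof -
  obtain B where B: "B \<ge> 0" "\<And>n x. int n + v \<ge> 0 \<Longrightarrow> \<bar>x\<bar> \<le> 1 / 2 \<Longrightarrow>
       \<bar>laplace_fun v n x - laplace_approx v K n x\<bar> \<le> B * \<bar>x\<bar> ^ K * exp (- (real n * x\<^sup>2 / 12))"
    using laplace_local_bound[of v K] by blast
  define a where "a = (\<lambda>k r. 2 * (1 / fact k * laplace_coeff v k (2 * r + s)))"
  define c where "c = (\<lambda>i. sqrt (2 * pi) / 2 * real (dfact (2 * i - 1)))"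
  \<comment> \<open>\<open>C1\<close> comes from the local error, a moment at
    \<open>a = n / 12\<close>; \<open>C2\<close> comes from the tails of the moments.\<close>
  define C1 where "C1 = 2 * B * (sqrt pi / 2 * (fact (2 * R) / (4 ^ R * fact R))) * (12 ^ R * sqrt 12)"
  define C2 where "C2 = (\<Sum>k<K. \<Sum>r<R. \<bar>a k r\<bar> * 4 ^ R * c (k + r + R))"
  have c: "c i \<ge> 0" for i by (simp add: c_def)
  have "C1 \<ge> 0" using B(1) by (simp add: C1_def)
  have "C2 \<ge> 0" using c by (auto simp: C2_def intro!: sum_nonneg)
  show ?thesis
  proof (rule that[of "C1 + C2"])
    show "C1 + C2 \<ge> 0" using \<open>C1 \<ge> 0\<close> \<open>C2 \<ge> 0\<close> by simp
    fix n :: nat assume n: "n \<ge> 1" "int n + v \<ge> 0"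
    then have n0: "real n > 0" by simp
    let ?D = "{0<..1/2::real}"
    define S where "S = (\<lambda>x. laplace_fun v n x / x ^ s + laplace_fun v n (- x) / (- x) ^ s)"
    define g where "g = (\<lambda>i x::real. x ^ (2 * i) * exp (- (real n / 2 * x\<^sup>2)))"
    define h where "h = (\<lambda>x::real. x ^ (2 * R) * exp (- (real n / 12 * x\<^sup>2)))"
    define Q where "Q = (\<lambda>x. \<Sum>k<K. \<Sum>r<R. (a k r * real n ^ k) * g (k + r) x)"
    have g: "set_integrable lborel ?D (g i)" "\<bar>(LBINT x:?D. g i x) - half_gaussian_moment i (real n / 2)\<bar> \<le> 4 ^ R * half_gaussian_moment (i + R) (real n / 2)" for i
      using gaussian_moment_truncated(1,3)[of "real n / 2" i] n0 by (auto simp: g_def)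
    have h: "set_integrable lborel ?D h" "(LBINT x:?D. h x) \<le> half_gaussian_moment R (real n / 12)"
      using gaussian_moment_truncated(1,2)[of "real n / 12" R] n0 by (auto simp: h_def)
    have S: "set_integrable lborel ?D S"
      using pv_integrable_laplace[OF n assms(1)] unfolding pv_integrable_def S_def by auto
    have Q: "set_integrable lborel ?D Q"
      unfolding Q_def using g(1) by (intro set_integrable_sum set_integrable_mult_right) auto
    have IQ: "(LBINT x:?D. Q x) = (\<Sum>k<K. \<Sum>r<R. (a k r * real n ^ k) * (LBINT x:?D. g (k + r) x))"
      unfolding Q_def using g(1)
      by (simp add: set_integral_sum set_integrable_sum)
    have "\<bar>LBINT x:?D. S x - Q x\<bar> \<le> (LBINT x:?D. (2 * B) * h x)"
    proof (rule set_integral_abs_le)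
      show "set_integrable lborel ?D (\<lambda>x. S x - Q x)" using S Q by simp
      show "set_integrable lborel ?D (\<lambda>x. (2 * B) * h x)" using h by simp
      fix x assume x: "x \<in> ?D"
      let ?E = "exp (- (real n * x\<^sup>2 / 12))"
      have "Q x = laplace_approx v K n x / x ^ s + laplace_approx v K n (- x) / (- x) ^ s"
        using laplace_approx_symmetrized[OF assms(1) _ assms(2), of x v n] x
        by (simp add: Q_def a_def g_def mult_ac)
      then have "S x - Q x = (laplace_fun v n x - laplace_approx v K n x) / x ^ s + (laplace_fun v n (- x) - laplace_approx v K n (- x)) / (- x) ^ s"
        by (simp add: S_def diff_divide_distrib)
      also have "\<bar>\<dots>\<bar> \<le> \<bar>laplace_fun v n x - laplace_approx v K n x\<bar> / x ^ s + \<bar>laplace_fun v n (- x) - laplace_approx v K n (- x)\<bar> / x ^ s"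
        using x by (intro order_trans[OF abs_triangle_ineq]) (simp add: power_abs)
      also have "\<dots> \<le> (B * \<bar>x\<bar> ^ K * ?E) / x ^ s + (B * \<bar>- x\<bar> ^ K * ?E) / x ^ s"
        using B(2)[OF n(2), of x] B(2)[OF n(2), of "- x"] x by (intro add_mono divide_right_mono) auto
      also have "\<dots> = (2 * B) * h x"
        using x assms(2) by (simp add: h_def power_add)
      finally show "\<bar>S x - Q x\<bar> \<le> (2 * B) * h x" .
    qed
    also have "\<dots> \<le> 2 * B * half_gaussian_moment R (real n / 12)"
      using h B(1) by (simp add: mult_left_mono)
    finally have 1: "\<bar>(LBINT x:?D. S x) - (LBINT x:?D. Q x)\<bar> \<le> 2 * B * half_gaussian_moment R (real n / 12)"
      using S Q by simp
    have e1: "sqrt (real n) * (2 * B * half_gaussian_moment R (real n / 12)) = C1 / real n ^ R"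
      using n0 by (simp add: C1_def half_gaussian_moment_def power_divide real_sqrt_divide)
    \<comment> \<open>The factor \<open>n ^ k\<close> of the exponential series cancels
      \<open>k\<close> of the powers in the moment, so the order in \<open>n\<close> depends on
      \<open>j\<close> alone.\<close>
    have gmh: "sqrt (real n) * (real n ^ k * half_gaussian_moment (k + j) (real n / 2)) = c (k + j) / real n ^ j" for k j
      using n0 half_gaussian_moment_eq_dfact[OF n(1), of "k + j"] by (simp add: c_def power_add)
    define G where "G = (\<Sum>k<K. \<Sum>r<R. (a k r * real n ^ k) * half_gaussian_moment (k + r) (real n / 2))"
    have "\<bar>(LBINT x:?D. Q x) - G\<bar> = \<bar>\<Sum>k<K. \<Sum>r<R. (a k r * real n ^ k) * ((LBINT x:?D. g (k + r) x) - half_gaussian_moment (k + r) (real n / 2))\<bar>"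
      by (simp add: IQ G_def sum_subtractf right_diff_distrib)
    also have "\<dots> \<le> (\<Sum>k<K. \<Sum>r<R. \<bar>(a k r * real n ^ k) * ((LBINT x:?D. g (k + r) x) - half_gaussian_moment (k + r) (real n / 2))\<bar>)"
      by (intro order_trans[OF sum_abs] sum_mono order_refl)
    also have "\<dots> \<le> (\<Sum>k<K. \<Sum>r<R. (\<bar>a k r\<bar> * real n ^ k) * (4 ^ R * half_gaussian_moment (k + r + R) (real n / 2)))"
      unfolding abs_mult by (intro sum_mono mult_mono g) auto
    finally have "sqrt (real n) * \<bar>(LBINT x:?D. Q x) - G\<bar> \<le> sqrt (real n) * \<dots>"
      by (intro mult_left_mono) auto
    also have "\<dots> = (\<Sum>k<K. \<Sum>r<R. \<bar>a k r\<bar> * 4 ^ R * (sqrt (real n) * (real n ^ k * half_gaussian_moment (k + (r + R)) (real n / 2))))"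
      by (simp add: sum_distrib_left mult_ac add_ac)
    also have "\<dots> \<le> (\<Sum>k<K. \<Sum>r<R. \<bar>a k r\<bar> * 4 ^ R * (c (k + r + R) / real n ^ R))"
    proof (intro sum_mono mult_left_mono)
      fix k r
      have "real n ^ R \<le> real n ^ (r + R)" using n by (intro power_increasing) auto
      then have "c (k + (r + R)) / real n ^ (r + R) \<le> c (k + (r + R)) / real n ^ R"
        using c n0 by (intro divide_left_mono) auto
      then show "sqrt (real n) * (real n ^ k * half_gaussian_moment (k + (r + R)) (real n / 2)) \<le> c (k + r + R) / real n ^ R"
        unfolding gmh by (simp add: add_ac)
    qed auto
    also have "\<dots> = C2 / real n ^ R"
      by (simp add: C2_def sum_divide_distrib mult_ac)
    finally have 2: "sqrt (real n) * \<bar>(LBINT x:?D. Q x) - G\<bar> \<le> C2 / real n ^ R" .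
    have "sqrt (real n) * G = (\<Sum>k<K. \<Sum>r<R. a k r * (sqrt (real n) * (real n ^ k * half_gaussian_moment (k + r) (real n / 2))))"
      by (simp add: G_def sum_distrib_left mult_ac)
    also have "\<dots> = (\<Sum>k<K. \<Sum>r<R. a k r * c (k + r) / real n ^ r)"
      unfolding gmh by simp
    also have "\<dots> = (\<Sum>r<R. \<Sum>k<K. a k r * c (k + r) / real n ^ r)" by (rule sum.swap)
    also have "\<dots> = sqrt (2 * pi) * (\<Sum>r<R. expansion_coeff v K s r / real n ^ r)"
      by (simp add: expansion_coeff_def a_def c_def sum_distrib_left sum_divide_distrib mult_ac)
    finally have 3: "sqrt (real n) * G = sqrt (2 * pi) * (\<Sum>r<R. expansion_coeff v K s r / real n ^ r)" .
    have "\<bar>sqrt (real n) * (LBINT x:?D. S x) - sqrt (real n) * G\<bar> = sqrt (real n) * \<bar>(LBINT x:?D. S x) - G\<bar>"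
      by (simp add: right_diff_distrib[symmetric] abs_mult)
    also have "\<dots> \<le> sqrt (real n) * (\<bar>(LBINT x:?D. S x) - (LBINT x:?D. Q x)\<bar> + \<bar>(LBINT x:?D. Q x) - G\<bar>)"
      by (intro mult_left_mono) auto
    also have "\<dots> \<le> sqrt (real n) * (2 * B * half_gaussian_moment R (real n / 12)) + C2 / real n ^ R"
      unfolding distrib_left by (intro add_mono 2 mult_left_mono 1) auto
    finally show "\<bar>sqrt (real n) * (LBINT x:?D. laplace_fun v n x / x ^ s + laplace_fun v n (- x) / (- x) ^ s)
       - sqrt (2 * pi) * (\<Sum>r<R. expansion_coeff v K s r / real n ^ r)\<bar> \<le> (C1 + C2) / real n ^ R"
      unfolding e1 3 S_def by (simp add: add_divide_distrib)
  qed
qed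

text \<open>On the two outer ranges the integrals decay like \<open>(24 / 25) ^ n\<close>, so even
  multiplied by \<open>sqrt n\<close> they are smaller than every power of
  \<open>1 / n\<close>.\<close>

lemma pv_laplace_expansion:
  assumes "s \<le> 1" "K = 2 * R + s"
  shows "(\<lambda>n. sqrt (real n) * pv (\<lambda>x. laplace_fun v n x / x ^ s)
       - sqrt (2 * pi) * (\<Sum>r<R. expansion_coeff v K s r / real n ^ r)) \<in> O(\<lambda>n. 1 / real n ^ R)"
proof -
  obtain C where C: "C \<ge> 0" "\<And>n. n \<ge> 1 \<Longrightarrow> int n + v \<ge> 0 \<Longrightarrow>
    \<bar>sqrt (real n) * (LBINT x:{0<..1/2}. laplace_fun v n x / x ^ s + laplace_fun v n (- x) / (- x) ^ s)
       - sqrt (2 * pi) * (\<Sum>r<R. expansion_coeff v K s r / real n ^ r)\<bar> \<le> C / real n ^ R"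
    using pv_laplace_local_expansion[OF assms] by blast
  \<comment> \<open>A fixed index at which the integrand has its intended exponent and is
    integrable; it serves as the dominating function.\<close>
  define n\<^sub>0 where "n\<^sub>0 = nat \<bar>v\<bar> + 1"
  have n\<^sub>0: "n\<^sub>0 \<ge> 1" "int n\<^sub>0 + v \<ge> 0" by (auto simp: n\<^sub>0_def)
  let ?A = "{1/2<..}::real set" and ?B = "{-1<..<-(1/2)}::real set"
  define J where "J = (\<lambda>A. LBINT x:A. 2 * laplace_fun v n\<^sub>0 x)"
  have tail: "\<bar>LBINT x:A. laplace_fun v n x / x ^ s\<bar> \<le> (24 / 25) ^ (n - n\<^sub>0) * J A"
    if n: "n \<ge> n\<^sub>0" and A: "A \<in> sets borel" "A \<subseteq> {-1<..}" "\<And>x. x \<in> A \<Longrightarrow> \<bar>x\<bar> \<ge> 1 / 2" for n A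
  proof -
    have i: "set_integrable lborel A (\<lambda>x. 2 * laplace_fun v n\<^sub>0 x)"
      using set_integrable_subset[OF laplace_set_integrable[OF n\<^sub>0(1), of v], of A] A
      by (intro set_integrable_mult_right) auto
    have "\<bar>LBINT x:A. laplace_fun v n x / x ^ s\<bar> \<le> (LBINT x:A. (24 / 25) ^ (n - n\<^sub>0) * (2 * laplace_fun v n\<^sub>0 x))"
    proof (rule set_integral_abs_le)
      show "set_integrable lborel A (\<lambda>x. laplace_fun v n x / x ^ s)"
        using n n\<^sub>0 A assms by (intro laplace_div_set_integrable) auto
      show "set_integrable lborel A (\<lambda>x. (24 / 25) ^ (n - n\<^sub>0) * (2 * laplace_fun v n\<^sub>0 x))"
        using i by (rule set_integrable_mult_right)
      fix x assume "x \<in> A"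
      then have x: "x > -1" "\<bar>x\<bar> \<ge> 1 / 2" using A by auto
      show "\<bar>laplace_fun v n x / x ^ s\<bar> \<le> (24 / 25) ^ (n - n\<^sub>0) * (2 * laplace_fun v n\<^sub>0 x)"
        using laplace_div_bound[OF assms(1) x, of v n] laplace_outside_bound[OF n n\<^sub>0(2) x] by simp
    qed
    also have "\<dots> = (24 / 25) ^ (n - n\<^sub>0) * J A" by (simp add: J_def)
    finally show ?thesis .
  qed
  let ?T = "\<lambda>n. sqrt (real n) * ((LBINT x:?A. laplace_fun v n x / x ^ s) + (LBINT x:?B. laplace_fun v n x / x ^ s))"
  have "?T \<in> O(\<lambda>n. sqrt (real n) * (24 / 25) ^ (n - n\<^sub>0))"
  proof (rule bigoI[where c = "\<bar>J ?A\<bar> + \<bar>J ?B\<bar>"])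
    show "\<forall>\<^sub>F n in sequentially. norm (?T n) \<le> (\<bar>J ?A\<bar> + \<bar>J ?B\<bar>) * norm (sqrt (real n) * (24 / 25) ^ (n - n\<^sub>0))"
      using eventually_ge_at_top[of n\<^sub>0]
    proof eventually_elim
      case (elim n)
      let ?q = "(24 / 25 :: real) ^ (n - n\<^sub>0)"
      have q: "?q \<ge> 0" by simp
      have a: "\<bar>LBINT x:?A. laplace_fun v n x / x ^ s\<bar> \<le> ?q * J ?A" by (rule tail[OF elim]) auto
      have b: "\<bar>LBINT x:?B. laplace_fun v n x / x ^ s\<bar> \<le> ?q * J ?B" by (rule tail[OF elim]) auto
      have c: "?q * J X \<le> ?q * \<bar>J X\<bar>" for X by (rule mult_left_mono) auto
      have "\<bar>(LBINT x:?A. laplace_fun v n x / x ^ s) + (LBINT x:?B. laplace_fun v n x / x ^ s)\<bar> \<le> ?q * \<bar>J ?A\<bar> + ?q * \<bar>J ?B\<bar>"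
        using a b c[of ?A] c[of ?B] by linarith
      then have "sqrt (real n) * \<bar>(LBINT x:?A. laplace_fun v n x / x ^ s) + (LBINT x:?B. laplace_fun v n x / x ^ s)\<bar> \<le> sqrt (real n) * (?q * \<bar>J ?A\<bar> + ?q * \<bar>J ?B\<bar>)"
        by (intro mult_left_mono) auto
      then show ?case unfolding real_norm_def abs_mult by (simp add: algebra_simps)
    qed
  qed
  \<comment> \<open>Replacing \<open>n - n\<^sub>0\<close> by \<open>n\<close> costs only a constant
    factor.\<close>
  also have "(\<lambda>n. sqrt (real n) * (24 / 25) ^ (n - n\<^sub>0)) \<in> O(\<lambda>n. sqrt (real n) * (24 / 25) ^ n)"
  proof (rule bigoI[where c = "(25 / 24) ^ n\<^sub>0"])
    show "\<forall>\<^sub>F n in sequentially. norm (sqrt (real n) * (24 / 25) ^ (n - n\<^sub>0)) \<le> (25 / 24) ^ n\<^sub>0 * norm (sqrt (real n) * (24 / 25) ^ n)"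
      using eventually_ge_at_top[of n\<^sub>0]
    proof eventually_elim
      case (elim n)
      then have "(24 / 25 :: real) ^ n = (24 / 25) ^ (n - n\<^sub>0) * (24 / 25) ^ n\<^sub>0"
        by (simp add: power_add[symmetric])
      then show ?case by (simp add: power_divide)
    qed
  qed
  also have "(\<lambda>n. sqrt (real n) * (24 / 25) ^ n) \<in> O(\<lambda>n. 1 / real n ^ R)"
    by real_asymp
  finally have T: "?T \<in> O(\<lambda>n. 1 / real n ^ R)" .
  have L: "(\<lambda>n. sqrt (real n) * (LBINT x:{0<..1/2}. laplace_fun v n x / x ^ s + laplace_fun v n (- x) / (- x) ^ s)
       - sqrt (2 * pi) * (\<Sum>r<R. expansion_coeff v K s r / real n ^ r)) \<in> O(\<lambda>n. 1 / real n ^ R)"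
  proof (rule bigoI[where c = C])
    show "\<forall>\<^sub>F n in sequentially. norm (sqrt (real n) * (LBINT x:{0<..1/2}. laplace_fun v n x / x ^ s + laplace_fun v n (- x) / (- x) ^ s)
       - sqrt (2 * pi) * (\<Sum>r<R. expansion_coeff v K s r / real n ^ r)) \<le> C * norm (1 / real n ^ R)"
      using eventually_ge_at_top[of n\<^sub>0]
    proof eventually_elim
      case (elim n)
      then have "n \<ge> 1" "int n + v \<ge> 0" using n\<^sub>0 by auto
      from C(2)[OF this] show ?case by simp
    qed
  qed
  show ?thesis
    using sum_in_bigo(1)[OF L T] unfolding pv_def by (simp add: algebra_simps)
qed

subsection \<open>The exponential integral as a principal value\<close>

text \<open>Away from 0, \<open>laplace_fun v n x / x\<close> and \<open>exp (- (n * x)) / x\<close>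
  differ by a finite sum of absolutely integrable functions, whose principal value is an ordinary
  integral.\<close>

lemma pv_exp_over_id:
  assumes "n \<ge> 1" "int n + v \<ge> 0"
  shows "pv_integrable (\<lambda>x. exp (- (real n * x)) / x)"
    and "pv (\<lambda>x. exp (- (real n * x)) / x) = pv (\<lambda>x. laplace_fun v n x / x)
       - (\<Sum>j<nat (int n + v). exp (real n) * fact j / real n ^ (j + 1))"
proof -
  define N where "N = nat (int n + v)"
  define S where "S = (\<lambda>x. \<Sum>j<N. (1 + x) ^ j * exp (- (real n * x)))"
  have S: "set_integrable lborel {-1<..} S"
    unfolding S_def by (intro set_integrable_sum shifted_Gamma_integral assms)
  have "(LBINT x:{-1<..}. S x) = (\<Sum>j<N. exp (real n) * fact j / real n ^ (j + 1))"
    unfolding S_def using shifted_Gamma_integral[OF assms(1)] by (simp add: set_integral_sum)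
  with pv_eq_integral[OF S] have pS: "pv_integrable S" "pv S = (\<Sum>j<N. exp (real n) * fact j / real n ^ (j + 1))"
    by simp_all
  have L: "pv_integrable (\<lambda>x. laplace_fun v n x / x)"
    using pv_integrable_laplace[OF assms, of 1] by simp
  have eq: "exp (- (real n * x)) / x = laplace_fun v n x / x - S x" if "x \<noteq> 0" for x
  proof -
    have "(1 + x) ^ N - 1 = x * (\<Sum>j<N. (1 + x) ^ j)"
      using power_diff_1_eq[of "1 + x" N] by simp
    then have "exp (- (real n * x)) * ((1 + x) ^ N - 1) = x * S x"
      by (simp add: S_def sum_distrib_left mult_ac)
    then show ?thesis using that by (simp add: laplace_fun_def N_def field_simps)
  qed
  show "pv_integrable (\<lambda>x. exp (- (real n * x)) / x)"
    using pv_diff(1)[OF L pS(1)] pv_cong(1)[OF eq] by simp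
  show "pv (\<lambda>x. exp (- (real n * x)) / x) = pv (\<lambda>x. laplace_fun v n x / x)
       - (\<Sum>j<nat (int n + v). exp (real n) * fact j / real n ^ (j + 1))"
    using pv_diff(2)[OF L pS(1)] pv_cong(2)[OF eq] pS(2) by (simp add: N_def)
qed

text \<open>Under \<open>t = - n * x\<close> the cuts at distance \<open>\<epsilon>\<close> from 0
  become cuts at distance \<open>\<epsilon> / n\<close>, still symmetric, and the endpoint
  \<open>t = n\<close> becomes \<open>x = -1\<close>.\<close>

lemma Ei_eq_pv:
  assumes "n \<ge> 1"
  shows "Ei (real n) = - pv (\<lambda>x. exp (- (real n * x)) / x)"
proof -
  define k where "k = (\<lambda>x. exp (- (real n * x)) / x)"
  have n: "real n > 0" using assms by simp
  have "set_integrable lborel {\<eta>..1/2} k" "set_integrable lborel {-(1/2)..-\<eta>} k" if "0 < \<eta>" for \<eta>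
    unfolding k_def using that by (auto intro!: borel_integrable_atLeastAtMost' continuous_intros)
  \<comment> \<open>The integrand is free of \<open>v\<close>, so its integrability is taken from
    the case \<open>v = 0\<close>.\<close>
  then have "((\<lambda>\<eta>. (LBINT x:{\<eta><..}. k x) + (LBINT x:{-1<..<-\<eta>}. k x)) \<longlongrightarrow> pv k) (at_right 0)"
    using pv_exp_over_id(1)[of n 0] assms by (intro pv_tendsto) (auto simp: k_def)
  moreover have "filterlim (\<lambda>\<epsilon>. \<epsilon> / real n) (at_right 0) (at_right 0)"
    using n by real_asymp
  ultimately have "((\<lambda>\<epsilon>. (LBINT x:{\<epsilon> / real n<..}. k x) + (LBINT x:{-1<..<-(\<epsilon> / real n)}. k x)) \<longlongrightarrow> pv k) (at_right 0)"
    by (rule filterlim_compose)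
  then have "((\<lambda>\<epsilon>. - ((LBINT x:{\<epsilon> / real n<..}. k x) + (LBINT x:{-1<..<-(\<epsilon> / real n)}. k x))) \<longlongrightarrow> - pv k) (at_right 0)"
    by (rule tendsto_minus)
  moreover have "eventually (\<lambda>\<epsilon>. - ((LBINT x:{\<epsilon> / real n<..}. k x) + (LBINT x:{-1<..<-(\<epsilon> / real n)}. k x)) =
      (LBINT t=-\<infinity>..ereal (-\<epsilon>). exp t / t) + (LBINT t=ereal \<epsilon>..ereal (real n). exp t / t)) (at_right 0)"
    using eventually_at_right_real[OF n]
  proof eventually_elim
    case (elim \<epsilon>)
    \<comment> \<open>The measure scales by \<open>n\<close>, which cancels in \<open>1 / t\<close>;
      the reflection leaves the sign.\<close>
    have sub: "(LBINT t:A. exp t / t) = - (LBINT x:A'. k x)" if "\<And>x. - (real n * x) \<in> A \<longleftrightarrow> x \<in> A'" for A A'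
    proof -
      have "(LBINT t:A. exp t / t) = real n * (LBINT x. indicator A (- (real n * x)) * (exp (- (real n * x)) / (- (real n * x))))"
        unfolding set_lebesgue_integral_def using n
        by (subst lborel_integral_real_affine[of "- real n" _ 0]) auto
      also have "\<dots> = (LBINT x. real n * (indicator A (- (real n * x)) * (exp (- (real n * x)) / (- (real n * x)))))"
        by (rule integral_mult_right_zero[symmetric])
      also have "\<dots> = (LBINT x. - (indicator A' x *\<^sub>R k x))"
        using n that by (intro Bochner_Integration.integral_cong) (auto simp: k_def indicator_def)
      also have "\<dots> = - (LBINT x:A'. k x)" by (simp add: set_lebesgue_integral_def)
      finally show ?thesis .
    qed
    have "(LBINT t=-\<infinity>..ereal (-\<epsilon>). exp t / t) = (LBINT t:{..<-\<epsilon>}. exp t / t)"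
      by (simp add: interval_lebesgue_integral_def)
    also have "\<dots> = - (LBINT x:{\<epsilon> / real n<..}. k x)"
      using n by (intro sub) (auto simp: field_simps)
    finally have 1: "(LBINT t=-\<infinity>..ereal (-\<epsilon>). exp t / t) = - (LBINT x:{\<epsilon> / real n<..}. k x)" .
    have "(LBINT t=ereal \<epsilon>..ereal (real n). exp t / t) = (LBINT t:{\<epsilon><..<real n}. exp t / t)"
      using elim by (simp add: interval_lebesgue_integral_def)
    also have "\<dots> = - (LBINT x:{-1<..<-(\<epsilon> / real n)}. k x)"
    proof (rule sub)
      fix x
      have "- (real n * x) < real n \<longleftrightarrow> real n * (-1) < real n * x" by auto
      also have "\<dots> \<longleftrightarrow> -1 < x" using n by (subst mult_less_cancel_left_pos) auto
      finally show "- (real n * x) \<in> {\<epsilon><..<real n} \<longleftrightarrow> x \<in> {-1<..<-(\<epsilon> / real n)}"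
        using n by (auto simp: field_simps)
    qed
    finally show ?case using 1 by simp
  qed
  ultimately have "((\<lambda>\<epsilon>. (LBINT t=-\<infinity>..ereal (-\<epsilon>). exp t / t) + (LBINT t=ereal \<epsilon>..ereal (real n). exp t / t))
      \<longlongrightarrow> - pv k) (at_right 0)"
    by (rule Lim_transform_eventually)
  then show ?thesis unfolding Ei_def k_def by (intro tendsto_Lim) auto
qed

text \<open>The terms subtracted in \<open>PsiN\<close> are exactly those of
  \<open>pv_exp_over_id\<close>. The remaining prefactor is minus the reciprocal of the denominator
  integral \<open>exp n * fact N / n ^ (N + 1)\<close>.\<close>

lemma PsiN_eq_pv_quotient:
  assumes "n \<ge> 1" "int n + v \<ge> 0"
  shows "PsiN n v = - pv (\<lambda>x. laplace_fun v n x / x ^ 1) / pv (\<lambda>x. laplace_fun v n x / x ^ 0)"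
    and "pv (\<lambda>x. laplace_fun v n x / x ^ 0) > 0"
proof -
  define N where "N = nat (int n + v)"
  define P where "P = pv (\<lambda>x. laplace_fun v n x / x)"
  have n: "real n > 0" using assms by simp
  have D: "pv (\<lambda>x. laplace_fun v n x / x ^ 0) = exp (real n) * fact N / real n ^ (N + 1)"
    using pv_eq_integral(2)[OF laplace_set_integrable[OF assms(1), of v]] shifted_Gamma_integral(2)[OF assms(1), of N]
    by (simp add: laplace_fun_def[abs_def] N_def)
  then show "pv (\<lambda>x. laplace_fun v n x / x ^ 0) > 0" using n by simp
  have "real n * exp (- real n) * Ei (real n) = - real n * exp (- real n) * P
      + (\<Sum>j<N. real n * exp (- real n) * (exp (real n) * fact j / real n ^ (j + 1)))"
    unfolding Ei_eq_pv[OF assms(1)] pv_exp_over_id(2)[OF assms] P_def N_def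
    by (simp add: algebra_simps sum_distrib_left)
  also have "(\<Sum>j<N. real n * exp (- real n) * (exp (real n) * fact j / real n ^ (j + 1))) = (\<Sum>j<N. fact j / real n ^ j)"
    using n by (intro sum.cong) (auto simp: exp_minus field_simps)
  finally have "PsiN n v = (- real n * exp (- real n) * P) * real n ^ N / fact N"
    by (simp add: PsiN_def N_def)
  also have "\<dots> = - P / (exp (real n) * fact N / real n ^ (N + 1))"
    using n by (simp add: exp_minus field_simps)
  finally show "PsiN n v = - pv (\<lambda>x. laplace_fun v n x / x ^ 1) / pv (\<lambda>x. laplace_fun v n x / x ^ 0)"
    unfolding D P_def by simp
qed

subsection \<open>Coefficients\<close>

text \<open>With \<open>a(x) = x/3 + x\<^sup>2/4 + ...\<close> one has
  \<open>w(x) = - a(- x)\<close>, which accounts for the sign.\<close>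

lemma phase_fps_power_nth:
  "fps_nth (phase_fps ^ k) m = (-1) ^ (m + k) * demoivre (\<lambda>j. 1 / real (j + 2)) m k"
proof (induction k arbitrary: m)
  case 0
  then show ?case by (simp add: demoivre_def)
next
  case (Suc k)
  define a where "a = Abs_fps (\<lambda>j. if j = 0 then 0 else 1 / real (j + 2))"
  have dm: "demoivre (\<lambda>j. 1 / real (j + 2)) m k = fps_nth (a ^ k) m" for m k
    by (simp only: demoivre_def a_def)
  have "fps_nth (phase_fps ^ Suc k) m = (\<Sum>i=0..m. fps_nth phase_fps i * fps_nth (phase_fps ^ k) (m - i))"
    by (simp add: fps_mult_nth)
  also have "\<dots> = (\<Sum>i=0..m. (-1) ^ (m + Suc k) * (fps_nth a i * fps_nth (a ^ k) (m - i)))"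
  proof (rule sum.cong)
    fix i assume "i \<in> {0..m}"
    then have sgn: "(-1::real) ^ (m + Suc k) = (-1) ^ (i + 1) * (-1) ^ (m - i + k)"
      by (simp add: power_add[symmetric])
    have "fps_nth phase_fps i = (-1) ^ (i + 1) * fps_nth a i"
      by (simp add: phase_fps_def a_def)
    then show "fps_nth phase_fps i * fps_nth (phase_fps ^ k) (m - i) = (-1) ^ (m + Suc k) * (fps_nth a i * fps_nth (a ^ k) (m - i))"
      unfolding Suc dm sgn by (simp only: mult_ac)
  qed simp
  also have "\<dots> = (-1) ^ (m + Suc k) * demoivre (\<lambda>j. 1 / real (j + 2)) m (Suc k)"
    unfolding dm by (simp add: fps_mult_nth sum_distrib_left)
  finally show ?case .
qed

lemma demoivre_eq_0: "m < k \<Longrightarrow> demoivre a m k = 0"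
  unfolding demoivre_def by (rule startsby_zero_power_prefix[rule_format]) auto

text \<open>\<open>demoivre a m k\<close> vanishes for \<open>k > m\<close>, and
  \<open>m \<le> 2 * r + s < K\<close>, so the sum over \<open>k\<close> stops at \<open>m\<close>
  and the truncation order \<open>K\<close> drops out.\<close>

lemma expansion_coeff_eq:
  assumes "2 * r + s < K"
  shows "expansion_coeff v K s r = (\<Sum>m=0..2*r+s. (-1) ^ m * ((real_of_int v) gchoose (2 * r + s - m)) * inner_sum r m)"
proof -
  let ?M = "2 * r + s" and ?A = "demoivre (\<lambda>j. 1 / real (j + 2))"
  have "expansion_coeff v K s r = (\<Sum>k<K. \<Sum>m=0..?M. real (dfact (2 * (k + r) - 1)) / fact k *
      ((-1) ^ (m + k) * ?A m k * ((real_of_int v) gchoose (?M - m))))"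
    unfolding expansion_coeff_def laplace_coeff_def fps_mult_nth phase_fps_power_nth by (simp add: sum_distrib_left)
  also have "\<dots> = (\<Sum>m=0..?M. \<Sum>k<K. real (dfact (2 * (k + r) - 1)) / fact k *
      ((-1) ^ (m + k) * ?A m k * ((real_of_int v) gchoose (?M - m))))"
    by (rule sum.swap)
  also have "\<dots> = (\<Sum>m=0..?M. (-1) ^ m * ((real_of_int v) gchoose (?M - m)) * inner_sum r m)"
  proof (rule sum.cong)
    fix m assume m: "m \<in> {0..?M}"
    have "(\<Sum>k<K. real (dfact (2 * (k + r) - 1)) / fact k * ((-1) ^ (m + k) * ?A m k * ((real_of_int v) gchoose (?M - m))))
      = (\<Sum>k=0..m. real (dfact (2 * (k + r) - 1)) / fact k * ((-1) ^ (m + k) * ?A m k * ((real_of_int v) gchoose (?M - m))))"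
      using m assms by (intro sum.mono_neutral_right) (auto simp: demoivre_eq_0)
    also have "\<dots> = (\<Sum>k=0..m. (-1) ^ m * ((real_of_int v) gchoose (?M - m)) *
        (real (dfact (2 * r + 2 * k - 1)) / ((-1) ^ k * fact k) * ?A m k))"
    proof (rule sum.cong)
      fix k
      have "2 * (k + r) - 1 = 2 * r + 2 * k - 1" by simp
      then show "real (dfact (2 * (k + r) - 1)) / fact k * ((-1) ^ (m + k) * ?A m k * ((real_of_int v) gchoose (?M - m)))
        = (-1) ^ m * ((real_of_int v) gchoose (?M - m)) * (real (dfact (2 * r + 2 * k - 1)) / ((-1) ^ k * fact k) * ?A m k)"
        by (cases "even k") (simp_all add: power_add)
    qed simp
    finally show "(\<Sum>k<K. real (dfact (2 * (k + r) - 1)) / fact k * ((-1) ^ (m + k) * ?A m k * ((real_of_int v) gchoose (?M - m))))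
      = (-1) ^ m * ((real_of_int v) gchoose (?M - m)) * inner_sum r m"
      by (simp add: inner_sum_def sum_distrib_left)
  qed simp
  finally show ?thesis .
qed

lemma expansion_coeff_gamma: "2 * r < K \<Longrightarrow> expansion_coeff v K 0 r = gammaR r v"
  using expansion_coeff_eq[of r 0 K v] by (simp add: gammaR_def)

lemma expansion_coeff_tau: "2 * r + 1 < K \<Longrightarrow> expansion_coeff v K 1 r = - tauR r v"
  using expansion_coeff_eq[of r 1 K v] by (simp add: tauR_def sum_negf[symmetric])

text \<open>The constant term 1 permits formal division by the gamma series and fixes the limit of
  the normalised denominator.\<close>

lemma gammaR_0: "gammaR 0 v = 1"
  by (simp add: gammaR_def inner_sum_def demoivre_def)

text \<open>The inner alternating sums in \<open>psiR\<close> are the coefficients of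
  \<open>1 / (1 + \<Gamma>)\<close>, obtained by composing the series \<open>E\<close> of
  \<open>1 / (1 + X)\<close> with \<open>\<Gamma>\<close>, and \<open>1 + \<Gamma>\<close> is the
  gamma series.\<close>

lemma psi_times_gamma:
  "Abs_fps (\<lambda>r. psiR r v) * Abs_fps (\<lambda>r. gammaR r v) = Abs_fps (\<lambda>r. tauR r v)"
proof -
  define \<Gamma> where "\<Gamma> = Abs_fps (\<lambda>j. if j = 0 then 0 else gammaR j v)"
  define E :: "real fps" where "E = Abs_fps (\<lambda>k. (-1) ^ k)"
  have \<Gamma>0: "fps_nth \<Gamma> 0 = 0" by (simp add: \<Gamma>_def)
  have E: "E * (1 + fps_X) = 1"
  proof (rule fps_ext)
    fix n show "fps_nth (E * (1 + fps_X)) n = fps_nth 1 n"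
      by (cases n) (auto simp: E_def distrib_left)
  qed
  have "(E oo \<Gamma>) * ((1 + fps_X) oo \<Gamma>) = 1"
    using fps_compose_mult_distrib[OF \<Gamma>0, of E "1 + fps_X"] by (simp add: E)
  then have inv: "(E oo \<Gamma>) * (1 + \<Gamma>) = 1"
    using \<Gamma>0 by (simp add: fps_compose_add_distrib)
  have G: "Abs_fps (\<lambda>r. gammaR r v) = 1 + \<Gamma>"
    by (rule fps_ext) (simp add: \<Gamma>_def gammaR_0)
  have "Abs_fps (\<lambda>r. psiR r v) = (E oo \<Gamma>) * Abs_fps (\<lambda>r. tauR r v)"
    unfolding psiR_def fps_eq_iff fps_mult_nth fps_nth_Abs_fps
    by (intro allI sum.cong) (simp_all add: fps_compose_nth E_def \<Gamma>_def demoivre_def mult.commute)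
  then show ?thesis using inv unfolding G by (simp add: mult.commute mult.left_commute)
qed

section \<open>Truncated expansions and their quotient\<close>

lemma fps_mult_truncation_bigo:
  fixes F G :: "real fps"
  shows "(\<lambda>n. (\<Sum>r<R. fps_nth F r / real n ^ r) * (\<Sum>r<R. fps_nth G r / real n ^ r)
     - (\<Sum>r<R. fps_nth (F * G) r / real n ^ r)) \<in> O(\<lambda>n. 1 / real n ^ R)"
proof -
  let ?t = "\<lambda>n i j. fps_nth F i * fps_nth G j / real n ^ (i + j)"
  let ?T = "{(i, j). i + j < R}" and ?S = "{..<R} \<times> {..<R}"
  have sub: "?T \<subseteq> ?S" by auto
  have "(\<Sum>r<R. fps_nth (F * G) r / real n ^ r) = (\<Sum>(i, j)\<in>?T. ?t n i j)" for n
    unfolding sum.triangle_reindex fps_mult_nth atMost_atLeast0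
    by (simp add: sum_divide_distrib)
  moreover have "(\<Sum>r<R. fps_nth F r / real n ^ r) * (\<Sum>r<R. fps_nth G r / real n ^ r) = (\<Sum>(i, j)\<in>?S. ?t n i j)" for n
    by (simp add: sum_product sum.cartesian_product power_add)
  \<comment> \<open>The product of the truncations runs over a square, the truncated product over a
    triangle; the leftover pairs satisfy \<open>i + j \<ge> R\<close>.\<close>
  ultimately have "(\<lambda>n. (\<Sum>r<R. fps_nth F r / real n ^ r) * (\<Sum>r<R. fps_nth G r / real n ^ r)
     - (\<Sum>r<R. fps_nth (F * G) r / real n ^ r)) = (\<lambda>n. \<Sum>(i, j)\<in>?S - ?T. ?t n i j)"
    using sub by (simp add: sum_diff)
  also have "\<dots> \<in> O(\<lambda>n. 1 / real n ^ R)"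
  proof (rule big_sum_in_bigo)
    fix p assume "p \<in> ?S - ?T"
    then obtain i j where p: "p = (i, j)" "i + j \<ge> R" by auto
    show "(\<lambda>n. case p of (i, j) \<Rightarrow> ?t n i j) \<in> O(\<lambda>n. 1 / real n ^ R)"
    proof (rule bigoI[where c = "\<bar>fps_nth F i * fps_nth G j\<bar>"])
      show "\<forall>\<^sub>F n in sequentially. norm (case p of (i, j) \<Rightarrow> ?t n i j) \<le> \<bar>fps_nth F i * fps_nth G j\<bar> * norm (1 / real n ^ R)"
        using eventually_ge_at_top[of 1]
      proof eventually_elim
        case (elim n)
        then have "real n ^ R \<le> real n ^ (i + j)" using p by (intro power_increasing) auto
        then have "\<bar>fps_nth F i * fps_nth G j\<bar> / real n ^ (i + j) \<le> \<bar>fps_nth F i * fps_nth G j\<bar> / real n ^ R"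
          using elim by (intro divide_left_mono) auto
        then show ?case by (simp add: p)
      qed
    qed
  qed
  finally show ?thesis .
qed

lemma sum_inverse_powers_bigo_1: "(\<lambda>n. \<Sum>r<R. c r / real n ^ r :: real) \<in> O(\<lambda>_. 1)"
proof (rule big_sum_in_bigo)
  fix r
  have "(\<lambda>n. c r / real n ^ r) \<in> O(\<lambda>n. 1 / real n ^ 0)"
  proof (rule bigoI[where c = "\<bar>c r\<bar>"])
    show "\<forall>\<^sub>F n in sequentially. norm (c r / real n ^ r) \<le> \<bar>c r\<bar> * norm (1 / real n ^ 0)"
      using eventually_ge_at_top[of 1]
    proof eventually_elim
      case (elim n)
      then have "\<bar>c r\<bar> / real n ^ r \<le> \<bar>c r\<bar> / 1" by (intro divide_left_mono) auto
      then show ?case by simp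
    qed
  qed
  then show "(\<lambda>n. c r / real n ^ r) \<in> O(\<lambda>_. 1)" by simp
qed

theorem theorem8p1:
  fixes v :: int and R :: nat
  assumes "R \<ge> 1"
  shows "(\<lambda>n. PsiN n v - (\<Sum>r<R. psiR r v / real n ^ r)) \<in> O(\<lambda>n. 1 / real n ^ R)"
proof -
  \<comment> \<open>The normalisation makes \<open>G\<close> tend to 1, and the sign in
    \<open>H\<close> gives \<open>PsiN n v = H n / G n\<close> for large \<open>n\<close>.\<close>
  define G where "G = (\<lambda>n. sqrt (real n) * pv (\<lambda>x. laplace_fun v n x / x ^ 0) / sqrt (2 * pi))"
  define H where "H = (\<lambda>n. - (sqrt (real n) * pv (\<lambda>x. laplace_fun v n x / x ^ 1)) / sqrt (2 * pi))"
  define S\<psi> where "S\<psi> = (\<lambda>n. \<Sum>r<R. psiR r v / real n ^ r)"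
  define S\<gamma> where "S\<gamma> = (\<lambda>n. \<Sum>r<R. gammaR r v / real n ^ r)"
  define S\<tau> where "S\<tau> = (\<lambda>n. \<Sum>r<R. tauR r v / real n ^ r)"
  \<comment> \<open>Needed at two orders: order 1 gives the limit of \<open>G\<close>, the given
    order the expansion.\<close>
  have G: "(\<lambda>n. G n - (\<Sum>r<R. gammaR r v / real n ^ r)) \<in> O(\<lambda>n. 1 / real n ^ R)" for R
  proof -
    have "(\<lambda>n. 1 / sqrt (2 * pi) * (sqrt (real n) * pv (\<lambda>x. laplace_fun v n x / x ^ 0)
       - sqrt (2 * pi) * (\<Sum>r<R. expansion_coeff v (2 * R + 0) 0 r / real n ^ r))) \<in> O(\<lambda>n. 1 / real n ^ R)"
      by (intro landau_o.big.cmult_in_iff[THEN iffD2] pv_laplace_expansion) auto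
    then show ?thesis by (simp add: G_def right_diff_distrib expansion_coeff_gamma)
  qed
  have H: "(\<lambda>n. H n - S\<tau> n) \<in> O(\<lambda>n. 1 / real n ^ R)"
  proof -
    have "(\<lambda>n. - 1 / sqrt (2 * pi) * (sqrt (real n) * pv (\<lambda>x. laplace_fun v n x / x ^ 1)
       - sqrt (2 * pi) * (\<Sum>r<R. expansion_coeff v (2 * R + 1) 1 r / real n ^ r))) \<in> O(\<lambda>n. 1 / real n ^ R)"
      by (intro landau_o.big.cmult_in_iff[THEN iffD2] pv_laplace_expansion) auto
    also have "(\<lambda>n. - 1 / sqrt (2 * pi) * (sqrt (real n) * pv (\<lambda>x. laplace_fun v n x / x ^ 1)
       - sqrt (2 * pi) * (\<Sum>r<R. expansion_coeff v (2 * R + 1) 1 r / real n ^ r))) = (\<lambda>n. H n - S\<tau> n)"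
    proof
      fix n
      have "(\<Sum>r<R. expansion_coeff v (2 * R + 1) 1 r / real n ^ r) = - S\<tau> n"
        unfolding S\<tau>_def sum_negf[symmetric] by (intro sum.cong refl) (subst expansion_coeff_tau, auto)
      then show "- 1 / sqrt (2 * pi) * (sqrt (real n) * pv (\<lambda>x. laplace_fun v n x / x ^ 1)
       - sqrt (2 * pi) * (\<Sum>r<R. expansion_coeff v (2 * R + 1) 1 r / real n ^ r)) = H n - S\<tau> n"
        by (simp only:) (simp add: H_def field_simps)
    qed
    finally show ?thesis .
  qed
  have "(\<lambda>n. G n - 1) \<in> O(\<lambda>n. 1 / real n)"
    using G[of 1] by (simp add: gammaR_0)
  also have "(\<lambda>n. 1 / real n) \<in> o(\<lambda>_. 1)" by real_asymp
  finally have "(\<lambda>n. G n - 1) \<longlonglongrightarrow> 0" by (auto dest: smalloD_tendsto)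
  then have "G \<longlonglongrightarrow> 1" by (simp add: LIM_zero_iff)
  then have G1: "eventually (\<lambda>n. G n > 1 / 2) sequentially" by (rule order_tendstoD) simp
  have P: "(\<lambda>n. S\<psi> n * S\<gamma> n - S\<tau> n) \<in> O(\<lambda>n. 1 / real n ^ R)"
    using fps_mult_truncation_bigo[of "Abs_fps (\<lambda>r. psiR r v)" R "Abs_fps (\<lambda>r. gammaR r v)"]
    unfolding psi_times_gamma by (simp add: S\<psi>_def S\<gamma>_def S\<tau>_def)
  have "(\<lambda>n. S\<psi> n * (G n - S\<gamma> n)) \<in> O(\<lambda>n. 1 * (1 / real n ^ R))"
    using G[of R] unfolding S\<psi>_def S\<gamma>_def by (intro landau_o.big.mult sum_inverse_powers_bigo_1)
  \<comment> \<open>The three errors combine so that \<open>S\<tau>\<close> and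
    \<open>S\<psi> n * S\<gamma> n\<close> cancel, leaving
    \<open>H n - S\<psi> n * G n\<close>.\<close>
  then have "(\<lambda>n. (H n - S\<tau> n) - S\<psi> n * (G n - S\<gamma> n) - (S\<psi> n * S\<gamma> n - S\<tau> n)) \<in> O(\<lambda>n. 1 / real n ^ R)"
    by (intro sum_in_bigo H P) simp
  then have D: "(\<lambda>n. H n - S\<psi> n * G n) \<in> O(\<lambda>n. 1 / real n ^ R)"
    by (simp add: algebra_simps)
  \<comment> \<open>Dividing by \<open>G n > 1 / 2\<close> costs at most the factor 2.\<close>
  have "(\<lambda>n. PsiN n v - S\<psi> n) \<in> O(\<lambda>n. H n - S\<psi> n * G n)"
  proof (rule bigoI[where c = 2])
    show "\<forall>\<^sub>F n in sequentially. norm (PsiN n v - S\<psi> n) \<le> 2 * norm (H n - S\<psi> n * G n)"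
      using G1 eventually_ge_at_top[of "nat \<bar>v\<bar> + 1"]
    proof eventually_elim
      case (elim n)
      then have n: "n \<ge> 1" "int n + v \<ge> 0" by auto
      have "PsiN n v = H n / G n"
        using PsiN_eq_pv_quotient[OF n] n by (simp add: G_def H_def)
      then have "PsiN n v - S\<psi> n = (H n - S\<psi> n * G n) / G n"
        using elim by (simp add: field_simps)
      then have "\<bar>PsiN n v - S\<psi> n\<bar> * G n = \<bar>H n - S\<psi> n * G n\<bar>"
        using elim by (simp add: abs_divide)
      moreover have "\<bar>PsiN n v - S\<psi> n\<bar> * (1 / 2) \<le> \<bar>PsiN n v - S\<psi> n\<bar> * G n"
        using elim by (intro mult_left_mono) auto
      ultimately show ?case by simp
    qed
  qed
  from landau_o.big_trans[OF this D] show ?thesis unfolding S\<psi>_def .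
qed

end
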